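(* Let $G$ be a connected graph. Then $G$ has a normal spanning tree if and only if its vertex set $V(G)$ is a countable union of $TK^{\aleph_0}$-dispersed sets, i.e.\ there exist sets $V_n \subseteq V(G)$, $n \in \mathbb{N}$, with $V(G) = \bigcup_{n \in \mathbb{N}} V_n$, such that each $V_n$ is $TK^{\aleph_0}$-dispersed in $G$.
   Context: Graphs may be infinite (of arbitrary cardinality). For a tree $T$ with root $r$, the tree-order $\leq_T$ is defined by $u \leq_T v$ if $u$ lies on the unique path from $r$ to $v$ in $T$. A rooted spanning tree $T$ of $G$ is normal if the end vertices of every edge of $G$ are comparable in $\leq_T$. A subdivided infinite clique in $G$ is a subgraph of $G$ that is a subdivision of the complete graph on countably infinitely many vertices. A set $U \subseteq V(G)$ is $TK^{\aleph_0}$-dispersed in $G$ if for every subdivided infinite clique $K \subseteq G$ there is a finite set $F \subseteq V(G)$ separating $U$ from $K$ (i.e.\ every path in $G$ from $U$ to $K$ meets $F$). *)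

theory Defs
  imports Main
begin

definition graph :: "'a set \<Rightarrow> ('a \<Rightarrow> 'a \<Rightarrow> bool) \<Rightarrow> bool" where
  "graph V E \<longleftrightarrow> (\<forall>x y. E x y \<longrightarrow> x \<in> V \<and> y \<in> V \<and> x \<noteq> y \<and> E y x)"

definition is_path :: "'a set \<Rightarrow> ('a \<Rightarrow> 'a \<Rightarrow> bool) \<Rightarrow> 'a list \<Rightarrow> bool" where
  "is_path V E xs \<longleftrightarrow> xs \<noteq> [] \<and> distinct xs \<and> set xs \<subseteq> V \<and>
     (\<forall>i. Suc i < length xs \<longrightarrow> E (xs ! i) (xs ! Suc i))"

definition connected_graph :: "'a set \<Rightarrow> ('a \<Rightarrow> 'a \<Rightarrow> bool) \<Rightarrow> bool" where
  "connected_graph V E \<longleftrightarrow> V \<noteq> {} \<and>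
     (\<forall>x\<in>V. \<forall>y\<in>V. \<exists>xs. is_path V E xs \<and> hd xs = x \<and> last xs = y)"

definition is_cycle :: "'a set \<Rightarrow> ('a \<Rightarrow> 'a \<Rightarrow> bool) \<Rightarrow> 'a list \<Rightarrow> bool" where
  "is_cycle V E xs \<longleftrightarrow> length xs \<ge> 3 \<and> is_path V E xs \<and> E (last xs) (hd xs)"

definition is_tree :: "'a set \<Rightarrow> ('a \<Rightarrow> 'a \<Rightarrow> bool) \<Rightarrow> bool" where
  "is_tree V T \<longleftrightarrow> connected_graph V T \<and> \<not> (\<exists>xs. is_cycle V T xs)"

definition spanning_tree :: "'a set \<Rightarrow> ('a \<Rightarrow> 'a \<Rightarrow> bool) \<Rightarrow> ('a \<Rightarrow> 'a \<Rightarrow> bool) \<Rightarrow> bool" where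
  "spanning_tree V E T \<longleftrightarrow> graph V T \<and> (\<forall>x y. T x y \<longrightarrow> E x y) \<and> is_tree V T"

definition tree_le :: "'a set \<Rightarrow> ('a \<Rightarrow> 'a \<Rightarrow> bool) \<Rightarrow> 'a \<Rightarrow> 'a \<Rightarrow> 'a \<Rightarrow> bool" where
  "tree_le V T r u v \<longleftrightarrow> (\<exists>xs. is_path V T xs \<and> hd xs = r \<and> last xs = v \<and> u \<in> set xs)"

definition normal_spanning_tree ::
  "'a set \<Rightarrow> ('a \<Rightarrow> 'a \<Rightarrow> bool) \<Rightarrow> ('a \<Rightarrow> 'a \<Rightarrow> bool) \<Rightarrow> 'a \<Rightarrow> bool" where
  "normal_spanning_tree V E T r \<longleftrightarrow> r \<in> V \<and> spanning_tree V E T \<and>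
     (\<forall>x y. E x y \<longrightarrow> tree_le V T r x y \<or> tree_le V T r y x)"

text \<open>K is the vertex set of a subdivided infinite clique in (V,E): injective
branch vertices b i (i :: nat) and, for i < j, paths P i j from b i to b j that
meet each other (and the branch vertices) only in common end vertices.\<close>

definition TK_aleph0 :: "'a set \<Rightarrow> ('a \<Rightarrow> 'a \<Rightarrow> bool) \<Rightarrow> 'a set \<Rightarrow> bool" where
  "TK_aleph0 V E K \<longleftrightarrow> (\<exists>(b :: nat \<Rightarrow> 'a) (P :: nat \<Rightarrow> nat \<Rightarrow> 'a list).
     inj b \<and>
     (\<forall>i j. i < j \<longrightarrow> is_path V E (P i j) \<and> hd (P i j) = b i \<and> last (P i j) = b j) \<and>
     (\<forall>i j. i < j \<longrightarrow> (\<forall>x\<in>set (P i j). x \<in> range b \<longrightarrow> x = b i \<or> x = b j)) \<and>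
     (\<forall>i j k l. i < j \<longrightarrow> k < l \<longrightarrow> (i, j) \<noteq> (k, l) \<longrightarrow>
        set (P i j) \<inter> set (P k l) \<subseteq> {b i, b j} \<inter> {b k, b l}) \<and>
     K = (\<Union>{set (P i j) | i j. i < j}))"

definition separates :: "'a set \<Rightarrow> ('a \<Rightarrow> 'a \<Rightarrow> bool) \<Rightarrow> 'a set \<Rightarrow> 'a set \<Rightarrow> 'a set \<Rightarrow> bool" where
  "separates V E F U K \<longleftrightarrow>
     (\<forall>xs. is_path V E xs \<and> hd xs \<in> U \<and> last xs \<in> K \<longrightarrow> set xs \<inter> F \<noteq> {})"

definition TK_dispersed :: "'a set \<Rightarrow> ('a \<Rightarrow> 'a \<Rightarrow> bool) \<Rightarrow> 'a set \<Rightarrow> bool" where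
  "TK_dispersed V E U \<longleftrightarrow>
     (\<forall>K. TK_aleph0 V E K \<longrightarrow> (\<exists>F. finite F \<and> F \<subseteq> V \<and> separates V E F U K))"

end

theory Submission
  imports Defs "HOL-Library.Nat_Bijection"
begin

text \<open>
  If \<open>T\<close> is a normal spanning tree, its levels are dispersed: branch vertices of a subdivided
  infinite clique are pairwise comparable, so all but finitely many of them lie above a single
  vertex of level \<open>n + 1\<close>, and the finitely many ancestors of that vertex separate them from
  level \<open>n\<close>.

  Conversely, grow a normal tree in countably many rounds. In each round every component \<open>D\<close> of
  the rest, whose neighbourhood is a finite chain, receives a path that starts next to the highest
  neighbour of \<open>D\<close> and ends in a prescribed target: a set \<open>V\<^sub>k\<close> or the neighbourhood of a fixed
  vertex below \<open>D\<close>, each being prescribed infinitely often. If a vertex \<open>w \<in> V\<^sub>k\<close> is never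
  reached, then along its branch infinitely many vertices keep having neighbours in the component
  of \<open>w\<close>. The paths added along the branch can be grouped into consecutive finite connected
  blocks, each meeting \<open>V\<^sub>k\<close> and each adjacent to all such vertices in earlier blocks. These
  blocks yield a subdivided infinite clique that no finite set separates from \<open>V\<^sub>k\<close>.
\<close>

subsection \<open>Linked vertices and components\<close>

lemma is_path_iff:
  "is_path V E xs \<longleftrightarrow> xs \<noteq> [] \<and> distinct xs \<and> set xs \<subseteq> V \<and> successively E xs"
  by (auto simp: is_path_def successively_conv_nth)

lemma is_path_appendD1: "is_path V E (xs @ ys) \<Longrightarrow> xs \<noteq> [] \<Longrightarrow> is_path V E xs"
  by (auto simp: is_path_iff successively_append_iff)

lemma is_path_appendD2: "is_path V E (xs @ ys) \<Longrightarrow> ys \<noteq> [] \<Longrightarrow> is_path V E ys"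
  by (auto simp: is_path_iff successively_append_iff)

lemma graph_symp: "graph V E \<Longrightarrow> symp E"
  by (auto simp: graph_def intro: sympI)

text \<open>Reachability by walks inside \<open>S\<close>. Vertices may repeat, unlike in
  \<open>is_path\<close>, so transitivity and monotonicity in \<open>S\<close> are plain
  inductions.\<close>

inductive linked :: "('a \<Rightarrow> 'a \<Rightarrow> bool) \<Rightarrow> 'a set \<Rightarrow> 'a \<Rightarrow> 'a \<Rightarrow> bool" for E S where
  refl: "x \<in> S \<Longrightarrow> linked E S x x"
| step: "linked E S x y \<Longrightarrow> E y z \<Longrightarrow> z \<in> S \<Longrightarrow> linked E S x z"

lemma linked_in: "linked E S x y \<Longrightarrow> x \<in> S \<and> y \<in> S"
  by (induction rule: linked.induct) auto

lemma linked_mono: "linked E S x y \<Longrightarrow> S \<subseteq> S' \<Longrightarrow> linked E S' x y"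
  by (induction rule: linked.induct) (auto intro: linked.intros)

lemma linked_edge: "E x y \<Longrightarrow> x \<in> S \<Longrightarrow> y \<in> S \<Longrightarrow> linked E S x y"
  by (auto intro: linked.intros)

lemma linked_trans: "linked E S y z \<Longrightarrow> linked E S x y \<Longrightarrow> linked E S x z"
  by (induction rule: linked.induct) (auto intro: linked.intros)

lemma linked_sym:
  assumes "symp E" "linked E S x y"
  shows "linked E S y x"
  using assms(2)
proof (induction rule: linked.induct)
  case (step x y z)
  then have "linked E S z y"
    using assms(1) by (auto intro: linked_edge dest: linked_in sympD)
  then show ?case using step linked_trans by metis
qed (auto intro: linked.intros)

lemma is_path_hd_linked: "is_path V E xs \<Longrightarrow> x \<in> set xs \<Longrightarrow> linked E (set xs) (hd xs) x"
proof (induction xs arbitrary: x rule: rev_induct)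
  case (snoc a xs)
  show ?case
  proof (cases "xs = []")
    case True
    then show ?thesis using snoc.prems by (auto intro: linked.intros)
  next
    case False
    then have p: "is_path V E xs" and e: "E (last xs) a"
      using snoc.prems by (auto simp: is_path_iff successively_append_iff)
    have l: "linked E (set (xs @ [a])) (hd xs) y" if "y \<in> set xs" for y
      using snoc.IH[OF p that] by (rule linked_mono) auto
    then have "linked E (set (xs @ [a])) (hd xs) a"
      using False e by (auto intro: linked.step[of _ _ _ "last xs"])
    then show ?thesis using l snoc.prems False by auto
  qed
qed (simp add: is_path_iff)

text \<open>A walk is shortened as it grows: when the next vertex already lies on the path, the path
  is cut back to it.\<close>

lemma linked_ex_path:
  "linked E S x y \<Longrightarrow> \<exists>xs. is_path S E xs \<and> hd xs = x \<and> last xs = y"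
proof (induction rule: linked.induct)
  case (refl x)
  then show ?case by (intro exI[of _ "[x]"]) (auto simp: is_path_iff)
next
  case (step x y z)
  then obtain xs where xs: "is_path S E xs" "hd xs = x" "last xs = y" by auto
  show ?case
  proof (cases "z \<in> set xs")
    case True
    then obtain ys zs where "xs = ys @ z # zs" by (auto dest: split_list)
    then have "xs = (ys @ [z]) @ zs" by simp
    then show ?thesis using xs is_path_appendD1[of S E "ys @ [z]" zs]
      by (intro exI[of _ "ys @ [z]"]) (auto simp: hd_append)
  next
    case False
    then show ?thesis using xs step.hyps
      by (intro exI[of _ "xs @ [z]"]) (auto simp: is_path_iff successively_append_iff)
  qed
qed

definition conn :: "('a \<Rightarrow> 'a \<Rightarrow> bool) \<Rightarrow> 'a set \<Rightarrow> bool" where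
  "conn E D \<longleftrightarrow> (\<forall>x\<in>D. \<forall>y\<in>D. linked E D x y)"

lemma conn_star:
  assumes "symp E" "\<And>x. x \<in> D \<Longrightarrow> linked E D r x"
  shows "conn E D"
  unfolding conn_def
proof (intro ballI)
  fix x y assume "x \<in> D" "y \<in> D"
  then have "linked E D x r" "linked E D r y" using assms linked_sym[OF assms(1)] by auto
  then show "linked E D x y" by (rule linked_trans[rotated])
qed

lemma conn_path: "symp E \<Longrightarrow> is_path V E xs \<Longrightarrow> conn E (set xs)"
  by (rule conn_star, assumption, rule is_path_hd_linked)

lemma connected_graph_conn:
  assumes "connected_graph V E"
  shows "conn E V"
  unfolding conn_def
proof (intro ballI)
  fix x y assume "x \<in> V" "y \<in> V"
  then obtain xs where xs: "is_path V E xs" "hd xs = x" "last xs = y"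
    using assms unfolding connected_graph_def by metis
  then have "linked E (set xs) x y" using is_path_hd_linked[of V E xs y]
    by (auto simp: is_path_iff)
  then show "linked E V x y" using xs by (auto simp: is_path_iff intro: linked_mono)
qed

lemma conn_Un:
  assumes "symp E" "conn E A" "conn E B" "a \<in> A" "b \<in> B" "E a b"
  shows "conn E (A \<union> B)"
proof (rule conn_star[OF assms(1), of _ a])
  fix x assume x: "x \<in> A \<union> B"
  have l: "linked E (A \<union> B) a y" if "y \<in> A" for y
    using assms that unfolding conn_def by (meson linked_mono sup_ge1)
  have "linked E (A \<union> B) a b" using assms by (auto intro: linked_edge)
  moreover have "linked E (A \<union> B) b y" if "y \<in> B" for y
    using assms that unfolding conn_def by (meson linked_mono sup_ge2)
  ultimately show "linked E (A \<union> B) a x" using x l linked_trans by (metis Un_iff)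
qed

lemma conn_boundary_edge:
  assumes "conn E D" "x \<in> D" "x \<in> C" "y \<in> D" "y \<notin> C"
  shows "\<exists>a\<in>D \<inter> C. \<exists>b\<in>D - C. E a b"
proof -
  have "linked E D x y" using assms by (simp add: conn_def)
  then show ?thesis using assms(3,5)
  proof (induction rule: linked.induct)
    case (step x y z)
    then show ?case using linked_in[OF step.hyps(1)] by (cases "y \<in> C") auto
  qed simp
qed

definition component :: "('a \<Rightarrow> 'a \<Rightarrow> bool) \<Rightarrow> 'a set \<Rightarrow> 'a \<Rightarrow> 'a set" where
  "component E S x = {y. linked E S x y}"

lemma component_subset: "component E S x \<subseteq> S"
  by (auto simp: component_def dest: linked_in)

lemma component_self: "x \<in> component E S x \<longleftrightarrow> x \<in> S"
  by (auto simp: component_def intro: linked.intros dest: linked_in)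

lemma component_eq:
  assumes "symp E" "y \<in> component E S x"
  shows "component E S y = component E S x"
proof -
  have "linked E S x y" "linked E S y x"
    using assms linked_sym[OF assms(1)] by (auto simp: component_def)
  then show ?thesis by (auto simp: component_def intro: linked_trans)
qed

lemma component_edge: "a \<in> component E S x \<Longrightarrow> E a b \<Longrightarrow> b \<in> S \<Longrightarrow> b \<in> component E S x"
  by (auto simp: component_def intro: linked.intros)

text \<open>Every vertex passed by a walk from \<open>x\<close> is itself reachable from
  \<open>x\<close>, so the walk never leaves the component.\<close>

lemma conn_component:
  assumes "symp E"
  shows "conn E (component E S x)"
proof (rule conn_star[OF assms, of _ x])
  fix y assume "y \<in> component E S x"
  then have "linked E S x y" by (simp add: component_def)
  then show "linked E (component E S x) x y"
  proof (induction rule: linked.induct)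
    case (refl x)
    then show ?case by (auto intro: linked.refl simp: component_self)
  next
    case (step x y z)
    then show ?case by (auto simp: component_def intro: linked.step)
  qed
qed

subsection \<open>Subdivided cliques from connected pieces\<close>

text \<open>Pieces with even index provide the branch vertices, those with odd index the subdivided
  edges, so that no subdivided edge runs through a third branch vertex.\<close>

lemma TK_from_pieces:
  fixes S :: "nat \<Rightarrow> 'a set" and v :: "nat \<Rightarrow> 'a"
  assumes "symp E"
    and S: "\<And>l. S l \<subseteq> V" "\<And>l. conn E (S l)" "\<And>i j. i \<noteq> j \<Longrightarrow> S i \<inter> S j = {}"
    and v: "\<And>l. v l \<in> S l" "\<And>i l. i < l \<Longrightarrow> \<exists>z\<in>S l. E (v i) z"
  shows "\<exists>K. TK_aleph0 V E K \<and> (\<forall>i. v (2 * i) \<in> K)"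
proof -
  define b where "b i = v (2 * i)" for i
  \<comment> \<open>The index of the piece reserved for the edge between \<open>b i\<close> and
    \<open>b j\<close>: odd, different for different pairs, and above \<open>2 * i\<close> and
    \<open>2 * j\<close>, so that both branch vertices have neighbours in that piece.\<close>
  define c where "c i j = 2 * prod_encode (i, j) + 1" for i j
  have c_gt: "2 * i < c i j" "2 * j < c i j" for i j
    using le_prod_encode_1[of i j] le_prod_encode_2[of j i] unfolding c_def by linarith+
  have c_inj: "c i j = c k l \<longleftrightarrow> (i, j) = (k, l)" for i j k l
    unfolding c_def by (simp add: prod_encode_eq)
  have disj: "x \<in> S i \<Longrightarrow> x \<in> S j \<Longrightarrow> i = j" for x i j using S(3) by blast
  have b_S: "b i \<in> S (2 * i)" for i using v by (simp add: b_def)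
  have b_notin: "b k \<notin> S (c i j)" for i j k
  proof
    assume "b k \<in> S (c i j)"
    then have "2 * k = c i j" using disj[OF b_S] by blast
    then show False unfolding c_def by presburger
  qed
  have b_inj: "b i = b j \<longleftrightarrow> i = j" for i j
    using disj[OF b_S[of i], of "2 * j"] b_S[of j] by auto
  have "\<exists>p. is_path (S (c i j)) E p \<and> E (b i) (hd p) \<and> E (last p) (b j)" for i j
  proof -
    obtain y z where yz: "y \<in> S (c i j)" "E (b i) y" "z \<in> S (c i j)" "E (b j) z"
      using v(2)[OF c_gt(1)[of i j]] v(2)[OF c_gt(2)[where i = i and j = j]] unfolding b_def by blast
    then have "linked E (S (c i j)) y z" using S(2) by (simp add: conn_def)
    then obtain p where "is_path (S (c i j)) E p" "hd p = y" "last p = z"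
      using linked_ex_path by metis
    then show ?thesis using yz sympD[OF assms(1)] by metis
  qed
  then obtain p where p: "\<And>i j. is_path (S (c i j)) E (p i j)"
      "\<And>i j. E (b i) (hd (p i j))" "\<And>i j. E (last (p i j)) (b j)"
    by metis
  define P where "P i j = b i # p i j @ [b j]" for i j
  have p_S: "set (p i j) \<subseteq> S (c i j)" for i j using p(1) by (simp add: is_path_iff)
  have set_P: "set (P i j) = {b i, b j} \<union> set (p i j)" for i j by (auto simp: P_def)
  have p_b: "b k \<notin> set (p i j)" for i j k using p_S b_notin by blast
  have p_disj: "set (p i j) \<inter> set (p k l) = {}" if "(i, j) \<noteq> (k, l)" for i j k l
  proof -
    have "S (c i j) \<inter> S (c k l) = {}" using S(3) c_inj that by metis
    then show ?thesis using p_S[of i j] p_S[of k l] by blast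
  qed
  have path: "is_path V E (P i j)" if "i < j" for i j
    using p(1)[of i j] p(2,3)[of i j] that p_S[of i j] S(1)[of "c i j"] S(1)[of "2 * i"]
      S(1)[of "2 * j"] b_S[of i] b_S[of j] p_b[of i i j] p_b[of j i j]
    by (auto simp: P_def is_path_iff successively_append_iff successively_Cons b_inj)
  have branch: "x = b i \<or> x = b j" if "x \<in> set (P i j)" "x \<in> range b" for i j x
    using that p_b by (auto simp: set_P)
  have cross: "set (P i j) \<inter> set (P k l) \<subseteq> {b i, b j} \<inter> {b k, b l}"
    if "(i, j) \<noteq> (k, l)" for i j k l
    using p_disj[OF that] p_b[of _ i j] p_b[of _ k l] by (auto simp: set_P)
  have ends: "hd (P i j) = b i" "last (P i j) = b j" for i j by (simp_all add: P_def)
  have "inj b" using b_inj by (auto simp: inj_def)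
  then have "TK_aleph0 V E (\<Union>{set (P i j) | i j. i < j})"
    unfolding TK_aleph0_def using path branch cross ends
    by (intro exI[of _ b] exI[of _ P] conjI allI impI ballI) (assumption | rule HOL.refl)+
  moreover have "v (2 * i) \<in> \<Union>{set (P i j) | i j. i < j}" for i
  proof (rule UnionI[of "set (P i (Suc i))"])
    show "set (P i (Suc i)) \<in> {set (P i j) | i j. i < j}" using lessI[of i] by blast
  qed (simp add: set_P b_def)
  ultimately show ?thesis by (intro exI[of _ "\<Union>{set (P i j) | i j. i < j}"] conjI allI)
qed

text \<open>The infinitely many disjoint pieces meeting \<open>U\<close> all send edges to the branch vertices.\<close>

lemma pieces_not_dispersed:
  fixes S :: "nat \<Rightarrow> 'a set" and v :: "nat \<Rightarrow> 'a"
  assumes "symp E"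
    and S: "\<And>l. S l \<subseteq> V" "\<And>l. conn E (S l)" "\<And>i j. i \<noteq> j \<Longrightarrow> S i \<inter> S j = {}"
    and v: "\<And>l. v l \<in> S l" "\<And>i l. i < l \<Longrightarrow> \<exists>z\<in>S l. E (v i) z"
    and U: "\<And>l. S l \<inter> U \<noteq> {}"
  shows "\<not> TK_dispersed V E U"
proof
  assume "TK_dispersed V E U"
  moreover obtain K where K: "TK_aleph0 V E K" "\<And>i. v (2 * i) \<in> K"
    using TK_from_pieces[where S = S and v = v, OF assms(1) S v] by blast
  ultimately obtain F where F: "finite F" "separates V E F U K"
    unfolding TK_dispersed_def by blast
  \<comment> \<open>The pieces are disjoint, so each point of \<open>F\<close> accounts for at most
    one of them.\<close>
  have "finite {l. S l \<inter> F \<noteq> {}}"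
  proof (rule finite_surj[of F])
    show "{l. S l \<inter> F \<noteq> {}} \<subseteq> (\<lambda>x. THE l. x \<in> S l) ` F"
    proof
      fix l assume "l \<in> {l. S l \<inter> F \<noteq> {}}"
      then obtain x where x: "x \<in> S l" "x \<in> F" by blast
      then have "(THE l. x \<in> S l) = l" using S(3) by (intro the_equality) blast+
      then show "l \<in> (\<lambda>x. THE l. x \<in> S l) ` F" using x by blast
    qed
  qed (rule F(1))
  then have "\<exists>N. \<forall>l\<in>{l. S l \<inter> F \<noteq> {}}. l < N" by (rule finite_nat_set_iff_bounded[THEN iffD1])
  then obtain N where N: "\<And>l. S l \<inter> F \<noteq> {} \<Longrightarrow> l < N" by blast
  \<comment> \<open>The pieces \<open>2 * N\<close> and \<open>2 * N + 1\<close> both miss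
    \<open>F\<close>. The even one supplies the vertex \<open>x\<close> of \<open>K\<close>, the odd
    one a path from \<open>U\<close> to a neighbour of \<open>x\<close>.\<close>
  define x where "x = v (2 * N)"
  let ?T = "S (2 * N + 1)"
  have x: "x \<in> S (2 * N)" unfolding x_def by (rule v(1))
  obtain z u where zu: "z \<in> ?T" "E x z" "u \<in> ?T" "u \<in> U"
    using v(2)[of "2 * N" "2 * N + 1"] U[of "2 * N + 1"] unfolding x_def by auto
  have "linked E (?T \<union> {x}) u z" using S(2) zu by (meson Un_upper1 conn_def linked_mono)
  then have "linked E (?T \<union> {x}) u x"
    using zu(2) sympD[OF assms(1)] by (auto intro: linked.step)
  then obtain xs where xs: "is_path (?T \<union> {x}) E xs" "hd xs = u" "last xs = x"
    using linked_ex_path by metis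
  then have "is_path V E xs" using S(1) x by (fastforce simp: is_path_iff)
  moreover have "hd xs \<in> U" "last xs \<in> K" using xs zu(4) K(2)[of N] by (simp_all add: x_def)
  ultimately have "set xs \<inter> F \<noteq> {}" using F(2) by (simp add: separates_def)
  then obtain f where "f \<in> set xs" "f \<in> F" by blast
  moreover have "set xs \<subseteq> ?T \<union> {x}" using xs(1) by (simp add: is_path_iff)
  ultimately have "?T \<inter> F \<noteq> {} \<or> S (2 * N) \<inter> F \<noteq> {}" using x by blast
  then show False using N[of "2 * N"] N[of "2 * N + 1"] by auto
qed

subsection \<open>Normal trees as ancestor lists\<close>

text \<open>A normal spanning tree with root \<open>r\<close>, encoded by the map \<open>A\<close> sending each
  vertex \<open>v\<close> to the list of vertices on the tree path from \<open>r\<close> to \<open>v\<close>.\<close>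

locale normal_ancestry =
  fixes V :: "'a set" and E :: "'a \<Rightarrow> 'a \<Rightarrow> bool" and r :: 'a and A :: "'a \<Rightarrow> 'a list"
  assumes graph: "graph V E"
    and root: "r \<in> V"
    and path: "v \<in> V \<Longrightarrow> is_path V E (A v)"
    and hd_A: "v \<in> V \<Longrightarrow> hd (A v) = r"
    and last_A: "v \<in> V \<Longrightarrow> last (A v) = v"
    and prefix_A: "v \<in> V \<Longrightarrow> A v = ys @ u # zs \<Longrightarrow> A u = ys @ [u]"
    and comparable: "E x y \<Longrightarrow> x \<in> set (A y) \<or> y \<in> set (A x)"
begin

lemma A_subset: "v \<in> V \<Longrightarrow> set (A v) \<subseteq> V"
  using path by (simp add: is_path_iff)

lemma A_nonempty: "v \<in> V \<Longrightarrow> A v \<noteq> []"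
  using path by (simp add: is_path_iff)

lemma A_self: "v \<in> V \<Longrightarrow> v \<in> set (A v)"
  using last_A A_nonempty last_in_set by metis

lemma ancestor_prefix:
  assumes "v \<in> V" "u \<in> set (A v)"
  shows "\<exists>zs. A v = A u @ zs"
proof -
  obtain ys zs where "A v = ys @ u # zs" using split_list[OF assms(2)] by blast
  then show ?thesis using prefix_A[OF assms(1)] by auto
qed

lemma ancestor_trans: "w \<in> V \<Longrightarrow> v \<in> set (A w) \<Longrightarrow> u \<in> set (A v) \<Longrightarrow> u \<in> set (A w)"
  using ancestor_prefix by fastforce

lemma ancestor_chain:
  assumes "w \<in> V" "u \<in> set (A w)" "v \<in> set (A w)"
  shows "u \<in> set (A v) \<or> v \<in> set (A u)"
proof -
  obtain ys zs where w: "A w = ys @ u # zs" using split_list[OF assms(2)] by blast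
  then have u: "A u = ys @ [u]" using prefix_A[OF assms(1)] by blast
  show ?thesis
  proof (cases "v \<in> set zs")
    case True
    then obtain zs1 zs2 where "zs = zs1 @ v # zs2" by (auto dest: split_list)
    then have "A v = (ys @ u # zs1) @ [v]"
      using prefix_A[OF assms(1), of "ys @ u # zs1" v zs2] w by simp
    then show ?thesis by simp
  qed (use w u assms(3) in auto)
qed

lemma ancestor_antisym:
  assumes "v \<in> V" "u \<in> set (A v)" "length (A v) \<le> length (A u)"
  shows "u = v"
proof -
  have "u \<in> V" using A_subset assms by blast
  moreover obtain zs where "A v = A u @ zs" using ancestor_prefix assms by blast
  ultimately show ?thesis using assms last_A[of u] last_A[of v] by auto
qed

text \<open>The separation property of normal trees. A visited common ancestor \<open>z\<close> of
  \<open>u\<close> and the current vertex is maintained along the walk. A step upwards keeps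
  \<open>z\<close>; a step down to an ancestor \<open>w'\<close> of \<open>w\<close> either keeps
  \<open>z\<close> or makes \<open>w'\<close> an ancestor of \<open>z\<close>, and then
  \<open>w'\<close> replaces it.\<close>

lemma linked_meets_common_ancestor:
  "linked E S u w \<Longrightarrow> S \<subseteq> V \<Longrightarrow> \<exists>z\<in>S. z \<in> set (A u) \<and> z \<in> set (A w)"
proof (induction rule: linked.induct)
  case (refl x)
  then show ?case using A_self by blast
next
  case (step u w w')
  then have V: "u \<in> V" "w \<in> V" "w' \<in> V" using linked_in by fastforce+
  obtain z where z: "z \<in> S" "z \<in> set (A u)" "z \<in> set (A w)" using step by blast
  have "z \<in> V" using z step.prems by blast
  consider "w \<in> set (A w')" | "w' \<in> set (A w)" using comparable step.hyps by blast
  then show ?case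
  proof cases
    case 1
    then show ?thesis using z ancestor_trans[OF V(3)] by blast
  next
    case 2
    then consider "z \<in> set (A w')" | "w' \<in> set (A z)"
      using ancestor_chain[OF V(2) z(3)] by blast
    then show ?thesis
    proof cases
      case 1
      then show ?thesis using z by blast
    next
      case 2
      then show ?thesis using z ancestor_trans[OF V(1)] step.hyps A_self[OF V(3)] by blast
    qed
  qed
qed

section \<open>The spanning tree defined by the ancestor lists\<close>

definition tree_edge :: "'a \<Rightarrow> 'a \<Rightarrow> bool" where
  "tree_edge x y \<longleftrightarrow> x \<in> V \<and> y \<in> V \<and> (A y = A x @ [y] \<or> A x = A y @ [x])"

lemma tree_edge_symp: "symp tree_edge"
  by (auto simp: tree_edge_def intro: sympI)

lemma tree_edge_imp_edge:
  assumes "tree_edge x y"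
  shows "E x y"
proof -
  have "E u v" if "A v = A u @ [v]" "u \<in> V" "v \<in> V" for u v
  proof -
    have "successively E (A u @ [v])" using path[OF that(3)] that(1) by (simp add: is_path_iff)
    then show ?thesis using that by (simp add: successively_append_iff A_nonempty last_A)
  qed
  then show ?thesis using assms graph unfolding tree_edge_def graph_def by blast
qed

lemma A_tree_path:
  assumes "v \<in> V"
  shows "is_path V tree_edge (A v)"
proof -
  have "tree_edge (A v ! i) (A v ! Suc i)" if "Suc i < length (A v)" for i
  proof -
    let ?a = "A v ! i" and ?b = "A v ! Suc i"
    have "A v = take (Suc i) (A v) @ ?b # drop (Suc (Suc i)) (A v)"
      using that by (rule id_take_nth_drop)
    then have "A ?b = take (Suc i) (A v) @ [?b]" using prefix_A[OF assms] by blast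
    moreover have "A v = take i (A v) @ ?a # drop (Suc i) (A v)"
      using that by (intro id_take_nth_drop) simp
    then have "A ?a = take i (A v) @ [?a]" using prefix_A[OF assms] by blast
    ultimately have "A ?b = A ?a @ [?b]" using that by (simp add: take_Suc_conv_app_nth)
    moreover have "?a \<in> V" "?b \<in> V" using A_subset[OF assms] that by (meson nth_mem Suc_lessD subsetD)+
    ultimately show ?thesis by (simp add: tree_edge_def)
  qed
  then show ?thesis using path[OF assms] by (simp add: is_path_def)
qed

text \<open>On a cycle, a vertex with the longest ancestor list would have its parent as both of its
  cycle neighbours, but these are distinct.\<close>

lemma tree_acyclic: "\<not> is_cycle V tree_edge xs"
proof
  assume "is_cycle V tree_edge xs"
  then have n: "length xs \<ge> 3" and xs: "is_path V tree_edge xs" and close: "tree_edge (last xs) (hd xs)"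
    by (auto simp: is_cycle_def)
  define n where "n = length xs"
  have ne: "xs \<noteq> []" using n by auto
  define f where "f i = length (A (xs ! i))" for i
  obtain i where i: "i < n" "\<And>j. j < n \<Longrightarrow> f j \<le> f i"
  proof -
    have "Max (f ` {..<n}) \<in> f ` {..<n}" using ne by (intro Max_in) (auto simp: n_def)
    then obtain i where "i < n" "f i = Max (f ` {..<n})" by auto
    then show ?thesis using that by (simp add: Max_ge)
  qed
  \<comment> \<open>The cyclic successor and predecessor of position \<open>i\<close>; they differ
    because the cycle has at least three vertices.\<close>
  define s where "s = (if Suc i = n then 0 else Suc i)"
  define p where "p = (if i = 0 then n - 1 else i - 1)"
  have lt: "s < n" "p < n" and "s \<noteq> p" using i n by (auto simp: s_def p_def n_def split: if_splits)
  have wrap: "tree_edge (xs ! (n - 1)) (xs ! 0)"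
    using close ne by (simp add: last_conv_nth hd_conv_nth n_def)
  have inner: "tree_edge (xs ! j) (xs ! Suc j)" if "Suc j < n" for j
    using xs that by (simp add: is_path_def n_def)
  have parent: "A (xs ! i) = A (xs ! j) @ [xs ! i]" if "tree_edge (xs ! i) (xs ! j)" "j < n" for j
    using that i(2)[OF that(2)] by (auto simp: tree_edge_def f_def)
  have "tree_edge (xs ! i) (xs ! s)"
    using wrap inner[of i] i(1) by (auto simp: s_def)
  moreover have "tree_edge (xs ! p) (xs ! i)"
    using wrap inner[of "i - 1"] i(1) by (auto simp: p_def)
  then have "tree_edge (xs ! i) (xs ! p)" using tree_edge_symp by (meson sympD)
  ultimately have "A (xs ! s) = A (xs ! p)" using parent lt by (metis append_same_eq)
  moreover have "xs ! s \<in> V" "xs ! p \<in> V" using lt xs by (auto simp: is_path_iff n_def)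
  ultimately have "xs ! s = xs ! p" using last_A by metis
  then show False using \<open>s \<noteq> p\<close> lt xs by (simp add: is_path_iff nth_eq_iff_index_eq n_def)
qed

lemma tree_edge_normal: "normal_spanning_tree V E tree_edge r"
proof -
  have root_linked: "linked tree_edge V r v" if "v \<in> V" for v
    using is_path_hd_linked[OF A_tree_path[OF that] A_self[OF that]] that
    by (auto simp: hd_A intro: linked_mono dest: A_subset)
  have "conn tree_edge V" using conn_star[OF tree_edge_symp root_linked] .
  then have "\<exists>xs. is_path V tree_edge xs \<and> hd xs = x \<and> last xs = y" if "x \<in> V" "y \<in> V" for x y
    using linked_ex_path that by (metis conn_def)
  then have "connected_graph V tree_edge" using root by (auto simp: connected_graph_def)
  then have "is_tree V tree_edge" using tree_acyclic by (simp add: is_tree_def)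
  moreover have "x \<in> V \<and> y \<in> V \<and> x \<noteq> y \<and> tree_edge y x" if "tree_edge x y" for x y
    using tree_edge_imp_edge[OF that] graph sympD[OF tree_edge_symp that] unfolding graph_def by simp
  then have "graph V tree_edge" by (simp add: graph_def)
  ultimately have "spanning_tree V E tree_edge"
    using tree_edge_imp_edge by (simp add: spanning_tree_def)
  moreover have le: "tree_le V tree_edge r x y" if "x \<in> set (A y)" "y \<in> V" for x y
    unfolding tree_le_def using A_tree_path hd_A last_A that by (intro exI[of _ "A y"]) simp
  have "tree_le V tree_edge r x y \<or> tree_le V tree_edge r y x" if "E x y" for x y
    using comparable[OF that] le graph that by (auto simp: graph_def)
  ultimately show ?thesis using root by (simp add: normal_spanning_tree_def)
qed

text \<open>Two branch vertices are joined by infinitely many independent paths, while incomparable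
  vertices are separated by their finitely many common ancestors.\<close>

lemma branch_vertices_comparable:
  fixes b :: "nat \<Rightarrow> 'a" and P :: "nat \<Rightarrow> nat \<Rightarrow> 'a list"
  assumes b: "inj b"
    and P: "\<And>i j. i < j \<Longrightarrow> is_path V E (P i j) \<and> hd (P i j) = b i \<and> last (P i j) = b j"
    and disj: "\<And>i j k l. i < j \<Longrightarrow> k < l \<Longrightarrow> (i, j) \<noteq> (k, l) \<Longrightarrow>
      set (P i j) \<inter> set (P k l) \<subseteq> {b i, b j} \<inter> {b k, b l}"
  shows "b i \<in> set (A (b j)) \<or> b j \<in> set (A (b i))"
proof (rule ccontr)
  assume inc: "\<not> ?thesis"
  define R where "R i j = (if i < j then set (P i j) else set (P j i))" for i j
  have sym: "symp E" using graph by (rule graph_symp)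
  have b_eq: "b k = b l \<longleftrightarrow> k = l" for k l using b by (simp add: inj_eq)
  have b_V: "b k \<in> V" for k
    using P[of k "Suc k"] hd_in_set[of "P k (Suc k)"] by (auto simp: is_path_iff)
  have ij: "i \<noteq> j" using inc A_self b_V by blast
  have linked_P: "linked E (set (P k l)) (b k) (b l)" if "k < l" for k l
    using P[OF that] is_path_hd_linked[of V E "P k l" "b l"] last_in_set[of "P k l"]
    by (auto simp: is_path_iff)
  have linked_R: "linked E (R k l) (b k) (b l)" if "k \<noteq> l" for k l
    using that linked_P[of k l] linked_sym[OF sym linked_P[of l k]]
    by (auto simp: R_def)
  have R_V: "R k l \<subseteq> V" if "k \<noteq> l" for k l
    using that P[of k l] P[of l k] by (auto simp: R_def is_path_iff)
  have disj_R: "R k l \<inter> R k' l' \<subseteq> {b k, b l} \<inter> {b k', b l'}"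
    if "k \<noteq> l" "k' \<noteq> l'" "{k, l} \<noteq> {k', l'}" for k l k' l'
  proof -
    have "set (P (min k l) (max k l)) \<inter> set (P (min k' l') (max k' l'))
        \<subseteq> {b (min k l), b (max k l)} \<inter> {b (min k' l'), b (max k' l')}"
      using that by (intro disj) (auto simp: min_def max_def split: if_splits)
    then show ?thesis using that by (auto simp: R_def min_def max_def split: if_splits)
  qed
  define I where "I = - {i, j}"
  \<comment> \<open>Each third branch vertex \<open>b k\<close> gives a route from
    \<open>b i\<close> to \<open>b j\<close>, which must contain a common ancestor of the
    two.\<close>
  have "\<exists>z. z \<in> R i k \<union> R k j \<and> z \<in> set (A (b i)) \<inter> set (A (b j))" if "k \<in> I" for k
  proof -
    have "linked E (R i k \<union> R k j) (b i) (b k)" "linked E (R i k \<union> R k j) (b k) (b j)"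
      using linked_R[of i k] linked_R[of k j] that
      by (auto simp: I_def intro: linked_mono)
    then have "linked E (R i k \<union> R k j) (b i) (b j)" by (rule linked_trans[rotated])
    moreover have "R i k \<union> R k j \<subseteq> V" using R_V that by (auto simp: I_def)
    ultimately show ?thesis using linked_meets_common_ancestor by fast
  qed
  then obtain f where f: "\<And>k. k \<in> I \<Longrightarrow> f k \<in> R i k \<union> R k j"
    "\<And>k. k \<in> I \<Longrightarrow> f k \<in> set (A (b i)) \<inter> set (A (b j))"
    by metis
  have f_ne: "f k \<noteq> b i" "f k \<noteq> b j" if "k \<in> I" for k
    using f(2)[OF that] inc by auto
  \<comment> \<open>Routes for different \<open>k\<close> share only \<open>b i\<close> and
    \<open>b j\<close>, and \<open>f\<close> avoids both. Infinitely many values would thus lie in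
    one finite ancestor list.\<close>
  have "inj_on f I"
  proof (rule inj_onI, rule ccontr)
    fix k l assume kl: "k \<in> I" "l \<in> I" "f k = f l" "k \<noteq> l"
    then have ne: "i \<noteq> k" "i \<noteq> l" "j \<noteq> k" "j \<noteq> l" by (auto simp: I_def)
    consider "f k \<in> R i k \<inter> R i l" | "f k \<in> R i k \<inter> R l j" | "f k \<in> R k j \<inter> R i l"
      | "f k \<in> R k j \<inter> R l j"
      using f(1)[OF kl(1)] f(1)[OF kl(2)] kl(3) by auto
    then show False
    proof cases
      case 1
      have "f k \<in> {b i, b k} \<inter> {b i, b l}"
        by (rule subsetD[OF disj_R 1]) (use ne kl ij in \<open>auto simp: doubleton_eq_iff\<close>)
      then show False using f_ne[OF kl(1)] kl ne ij b_eq by auto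
    next
      case 2
      have "f k \<in> {b i, b k} \<inter> {b l, b j}"
        by (rule subsetD[OF disj_R 2]) (use ne kl ij in \<open>auto simp: doubleton_eq_iff\<close>)
      then show False using f_ne[OF kl(1)] kl ne ij b_eq by auto
    next
      case 3
      have "f k \<in> {b k, b j} \<inter> {b i, b l}"
        by (rule subsetD[OF disj_R 3]) (use ne kl ij in \<open>auto simp: doubleton_eq_iff\<close>)
      then show False using f_ne[OF kl(1)] kl ne ij b_eq by auto
    next
      case 4
      have "f k \<in> {b k, b j} \<inter> {b l, b j}"
        by (rule subsetD[OF disj_R 4]) (use ne kl ij in \<open>auto simp: doubleton_eq_iff\<close>)
      then show False using f_ne[OF kl(1)] kl ne ij b_eq by auto
    qed
  qed
  moreover have "finite (f ` I)"
    using f(2) by (intro finite_subset[of "f ` I" "set (A (b i))"]) auto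
  ultimately have "finite I" by (rule finite_imageD[rotated])
  then show False by (simp add: I_def finite_compl)
qed

text \<open>All branch vertices with more than \<open>n + 1\<close> ancestors share their first
  \<open>n + 1\<close> ancestors, which form \<open>F0\<close> and cut these deep vertices off from
  the level. Only finitely many subdivided edges fail to lead to a deep branch vertex outside
  \<open>F0\<close>, and these are put into \<open>F\<close> whole.\<close>

lemma level_separated:
  fixes b :: "nat \<Rightarrow> 'a" and P :: "nat \<Rightarrow> nat \<Rightarrow> 'a list"
  assumes b: "inj b"
    and P: "\<And>i j. i < j \<Longrightarrow> is_path V E (P i j) \<and> hd (P i j) = b i \<and> last (P i j) = b j"
    and K: "K = (\<Union>{set (P i j) | i j. i < j})"
    and disj: "\<And>i j k l. i < j \<Longrightarrow> k < l \<Longrightarrow> (i, j) \<noteq> (k, l) \<Longrightarrow>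
      set (P i j) \<inter> set (P k l) \<subseteq> {b i, b j} \<inter> {b k, b l}"
  shows "\<exists>F. finite F \<and> F \<subseteq> V \<and> separates V E F {v \<in> V. length (A v) = Suc n} K"
proof -
  have sym: "symp E" using graph by (rule graph_symp)
  have comp: "b i \<in> set (A (b j)) \<or> b j \<in> set (A (b i))" for i j
    using branch_vertices_comparable[where b = b and P = P, OF b P disj] by blast
  have b_V: "b k \<in> V" for k
    using P[of k "Suc k"] hd_in_set[of "P k (Suc k)"] by (auto simp: is_path_iff)
  define B where "B = {i. length (A (b i)) \<le> Suc n}"
  \<comment> \<open>Comparable vertices of equal depth coincide, so only finitely many branch
    vertices are shallow.\<close>
  have "inj (\<lambda>i. length (A (b i)))"
  proof (rule injI)
    fix i j assume "length (A (b i)) = length (A (b j))"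
    then have "b i = b j" using comp[of i j] ancestor_antisym b_V by fastforce
    then show "i = j" using b by (simp add: inj_eq)
  qed
  then have "finite ((\<lambda>i. length (A (b i))) -` {..Suc n})" by (intro finite_vimageI) auto
  moreover have "B = (\<lambda>i. length (A (b i))) -` {..Suc n}" by (auto simp: B_def)
  ultimately have fin_B: "finite B" by simp
  obtain i0 where i0: "i0 \<notin> B" using ex_new_if_finite[OF infinite_UNIV_nat fin_B] by blast
  define F0 where "F0 = set (take (Suc n) (A (b i0)))"
  \<comment> \<open>Of the two comparable lists one is a prefix of the other, and both are longer
    than \<open>Suc n\<close>.\<close>
  have F0: "set (take (Suc n) (A (b j))) = F0" if "j \<notin> B" for j
  proof -
    consider zs where "A (b j) = A (b i0) @ zs" | zs where "A (b i0) = A (b j) @ zs"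
      using comp[of i0 j] ancestor_prefix b_V by blast
    then show ?thesis using that i0 by cases (auto simp: F0_def B_def)
  qed
  \<comment> \<open>A common ancestor on the walk is no deeper than \<open>u\<close>, hence among
    the first \<open>Suc n\<close> ancestors of \<open>b j\<close>; for a deep \<open>b j\<close>
    this is a vertex of \<open>F0\<close>.\<close>
  have far: "j \<in> B" if u: "length (A u) = Suc n" and S: "linked E S u (b j)" "S \<subseteq> V" "S \<inter> F0 = {}"
    for u S j
  proof (rule ccontr)
    assume j: "j \<notin> B"
    obtain z where z: "z \<in> S" "z \<in> set (A u)" "z \<in> set (A (b j))"
      using linked_meets_common_ancestor[OF S(1,2)] by blast
    have "u \<in> V" using linked_in[OF S(1)] S(2) by blast
    then have le: "length (A z) \<le> Suc n" using ancestor_prefix[OF _ z(2)] u by fastforce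
    obtain zs where zs: "A (b j) = A z @ zs" using ancestor_prefix[OF b_V z(3)] by blast
    have "z \<in> set (A z)" using z(1) S(2) A_self by blast
    then have "z \<in> set (take (Suc n) (A (b j)))" using le zs by simp
    then show False using F0[OF j] z(1) S(3) by blast
  qed
  have F0_B: "i \<in> B" if "b i \<in> F0" for i
  proof -
    obtain ys zs where eq: "take (Suc n) (A (b i0)) = ys @ b i # zs"
      using \<open>b i \<in> F0\<close> unfolding F0_def by (meson split_list)
    then have "A (b i0) = ys @ b i # (zs @ drop (Suc n) (A (b i0)))"
      by (metis append_Cons append_assoc append_take_drop_id)
    then have "A (b i) = ys @ [b i]" using prefix_A[OF b_V] by blast
    moreover have "length (ys @ b i # zs) \<le> Suc n" unfolding eq[symmetric] by simp
    ultimately show ?thesis by (simp add: B_def)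
  qed
  define inner where "inner p = set (P (fst p) (snd p)) - {b (fst p), b (snd p)}" for p
  define bad where "bad = {p. fst p < snd p \<and> inner p \<inter> F0 \<noteq> {}}"
  have "finite bad"
  proof -
    have "\<forall>p\<in>bad. \<exists>z. z \<in> inner p \<inter> F0" by (auto simp: bad_def)
    then obtain g where g: "\<And>p. p \<in> bad \<Longrightarrow> g p \<in> inner p \<inter> F0" by metis
    have "inj_on g bad"
    proof (rule inj_onI, rule ccontr)
      fix p q assume pq: "p \<in> bad" "q \<in> bad" "g p = g q" "p \<noteq> q"
      have "g p \<in> inner p" "g p \<in> inner q" using g[OF pq(1)] g[OF pq(2)] pq(3) by auto
      moreover have "set (P (fst p) (snd p)) \<inter> set (P (fst q) (snd q)) \<subseteq> {b (fst p), b (snd p)}"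
        using disj[of "fst p" "snd p" "fst q" "snd q"] pq by (auto simp: bad_def prod_eq_iff)
      ultimately show False unfolding inner_def by blast
    qed
    moreover have "finite (g ` bad)"
      using g by (intro finite_subset[of "g ` bad" F0]) (auto simp: F0_def)
    ultimately show ?thesis by (rule finite_imageD[rotated])
  qed
  \<comment> \<open>Added whole are the edges whose interior meets \<open>F0\<close>, finitely many
    since interiors are disjoint, and the edges with two shallow ends. Any other edge has a deep end
    and an interior avoiding \<open>F0\<close>.\<close>
  define F where "F = F0 \<union> (\<Union>p\<in>bad \<union> {p \<in> B \<times> B. fst p < snd p}. set (P (fst p) (snd p)))"
  have "finite F" using \<open>finite bad\<close> fin_B unfolding F_def F0_def by auto
  moreover have "F \<subseteq> V"
  proof -
    have "F0 \<subseteq> V" using A_subset[OF b_V] set_take_subset unfolding F0_def by fast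
    moreover have "set (P i j) \<subseteq> V" if "i < j" for i j using P[OF that] by (simp add: is_path_iff)
    ultimately show ?thesis unfolding F_def bad_def by auto
  qed
  moreover have "separates V E F {v \<in> V. length (A v) = Suc n} K"
    unfolding separates_def
  proof (intro allI impI notI)
    fix xs
    assume xs: "is_path V E xs \<and> hd xs \<in> {v \<in> V. length (A v) = Suc n} \<and> last xs \<in> K"
      and avoid: "set xs \<inter> F = {}"
    define z where "z = last xs"
    have z_xs: "z \<in> set xs" using xs unfolding z_def by (simp add: is_path_iff)
    obtain i j where ij: "i < j" "z \<in> set (P i j)" using xs K unfolding z_def by blast
    then have good: "(i, j) \<notin> bad" "\<not> (i \<in> B \<and> j \<in> B)"
      using avoid z_xs unfolding F_def by force+
    have in_F0: "x = b i \<or> x = b j" if "x \<in> set (P i j)" "x \<in> F0" for x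
      using good(1) that ij(1) by (auto simp: bad_def inner_def)
    have z_F0: "z \<notin> F0" using avoid z_xs by (auto simp: F_def)
    obtain ys zs where eq: "P i j = ys @ z # zs" using split_list[OF ij(2)] by blast
    have path: "is_path V E (ys @ z # zs)" "hd (ys @ z # zs) = b i" "last (ys @ z # zs) = b j"
      using P[OF ij(1)] eq by auto
    have xs_linked: "linked E (set xs) (hd xs) z" using is_path_hd_linked[of V E xs z] xs z_xs by simp
    have extend: "k \<in> B" if S: "linked E S z (b k)" "S \<subseteq> set (P i j)" "S \<inter> F0 = {}" for k S
    proof (rule far)
      show "length (A (hd xs)) = Suc n" using xs by simp
      have "linked E (set xs \<union> S) z (b k)" using S(1) by (rule linked_mono) simp
      moreover have "linked E (set xs \<union> S) (hd xs) z" using xs_linked by (rule linked_mono) simp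
      ultimately show "linked E (set xs \<union> S) (hd xs) (b k)" by (rule linked_trans)
      show "set xs \<union> S \<subseteq> V" using xs S(2) P[OF ij(1)] by (auto simp: is_path_iff)
      show "(set xs \<union> S) \<inter> F0 = {}" using S(3) avoid by (auto simp: F_def)
    qed
    \<comment> \<open>If \<open>b j\<close> were deep, the segment from \<open>z\<close> to
      \<open>b j\<close> would avoid \<open>F0\<close>: only the ends of the edge could lie in
      \<open>F0\<close>, \<open>b j\<close> is too deep, and \<open>b i\<close> is met again only if
      it equals \<open>z\<close>, which is outside \<open>F0\<close>. This contradicts
      \<open>far\<close>; the case of \<open>b i\<close> uses the reversed initial segment.\<close>
    have "j \<in> B"
    proof (rule ccontr)
      assume j: "j \<notin> B"
      have "is_path V E (z # zs)" using is_path_appendD2[OF path(1)] by simp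
      then have "linked E (set (z # zs)) z (b j)"
        using is_path_hd_linked[of V E "z # zs" "b j"] path(3) last_in_set[of "z # zs"] by auto
      moreover have "set (z # zs) \<inter> F0 = {}"
      proof (rule ccontr)
        assume "set (z # zs) \<inter> F0 \<noteq> {}"
        then obtain x where x: "x \<in> set (z # zs)" "x \<in> F0" by blast
        then have "x = b i" using in_F0[of x] eq F0_B[of j] j by auto
        moreover have "b i \<notin> set zs" using path(1,2) by (cases ys) (auto simp: is_path_iff)
        ultimately show False using x z_F0 by auto
      qed
      ultimately show False using extend[of "set (z # zs)" j] j eq by auto
    qed
    moreover have "i \<in> B"
    proof (rule ccontr)
      assume i: "i \<notin> B"
      have "is_path V E (ys @ [z])" using is_path_appendD1[of V E "ys @ [z]" zs] path(1) by simp
      then have "linked E (set (ys @ [z])) (b i) z"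
        using is_path_hd_linked[of V E "ys @ [z]" z] path(2) by (cases ys) auto
      then have "linked E (set (ys @ [z])) z (b i)" by (rule linked_sym[OF sym])
      moreover have "set (ys @ [z]) \<inter> F0 = {}"
      proof (rule ccontr)
        assume "set (ys @ [z]) \<inter> F0 \<noteq> {}"
        then obtain x where x: "x \<in> set (ys @ [z])" "x \<in> F0" by blast
        then have "x = b j" using in_F0[of x] eq F0_B[of i] i by auto
        moreover have "b j \<notin> set ys" using path(1,3) last_in_set[of "z # zs"] by (auto simp: is_path_iff)
        ultimately show False using x z_F0 by auto
      qed
      ultimately show False using extend[of "set (ys @ [z])" i] i eq by auto
    qed
    ultimately show False using good(2) by blast
  qed
  ultimately show ?thesis by blast
qed

lemma level_dispersed: "TK_dispersed V E {v \<in> V. length (A v) = Suc n}"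
  unfolding TK_dispersed_def
proof (intro allI impI)
  fix K assume "TK_aleph0 V E K"
  then obtain b :: "nat \<Rightarrow> 'a" and P where bP: "inj b"
    "\<forall>i j. i < j \<longrightarrow> is_path V E (P i j) \<and> hd (P i j) = b i \<and> last (P i j) = b j"
    "\<forall>i j k l. i < j \<longrightarrow> k < l \<longrightarrow> (i, j) \<noteq> (k, l) \<longrightarrow>
      set (P i j) \<inter> set (P k l) \<subseteq> {b i, b j} \<inter> {b k, b l}"
    "K = (\<Union>{set (P i j) | i j. i < j})"
    unfolding TK_aleph0_def by (elim exE conjE) (rule that; assumption)
  show "\<exists>F. finite F \<and> F \<subseteq> V \<and> separates V E F {v \<in> V. length (A v) = Suc n} K"
    by (rule level_separated[OF bP(1) bP(2)[rule_format] bP(4) bP(3)[rule_format]])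
qed

end

section \<open>From a normal spanning tree to ancestor lists\<close>

text \<open>If the second vertices differed, the two tails would connect them without using
  \<open>x\<close>, and \<open>x\<close> would close a cycle.\<close>

lemma acyclic_path_unique:
  assumes "graph V T" "\<nexists>xs. is_cycle V T xs"
  shows "is_path V T xs \<Longrightarrow> is_path V T ys \<Longrightarrow> hd xs = hd ys \<Longrightarrow> last xs = last ys \<Longrightarrow> xs = ys"
proof (induction xs arbitrary: ys)
  case (Cons x xs')
  obtain ys' where ys: "ys = x # ys'" using Cons.prems by (cases ys) (auto simp: is_path_iff)
  show ?case
  proof (cases "xs' = [] \<or> ys' = []")
    case True
    then show ?thesis using Cons.prems ys
      by (auto simp: is_path_iff split: if_splits dest: last_in_set)
  next
    case False
    have px: "is_path V T xs'" and py: "is_path V T ys'"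
      using Cons.prems False ys is_path_appendD2[of V T "[x]"] by auto
    have ends: "last xs' = last ys'" using Cons.prems False ys by simp
    have T: "T x (hd xs')" "T x (hd ys')"
      using Cons.prems False ys by (auto simp: is_path_iff successively_Cons)
    have "hd xs' = hd ys'"
    proof (rule ccontr)
      assume neq: "hd xs' \<noteq> hd ys'"
      have x: "x \<in> V" "x \<notin> set xs'" "x \<notin> set ys'"
        using Cons.prems ys by (auto simp: is_path_iff)
      have sub: "set xs' \<subseteq> V - {x}" "set ys' \<subseteq> V - {x}"
        using px py x by (auto simp: is_path_iff)
      have "linked T (V - {x}) (hd xs') (last xs')" "linked T (V - {x}) (hd ys') (last ys')"
        using is_path_hd_linked[OF px] is_path_hd_linked[OF py] False sub
        by (meson last_in_set linked_mono)+
      then have "linked T (V - {x}) (hd xs') (hd ys')"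
        using ends linked_sym[OF graph_symp[OF assms(1)]] linked_trans by metis
      then obtain zs where zs: "is_path (V - {x}) T zs" "hd zs = hd xs'" "last zs = hd ys'"
        using linked_ex_path by metis
      then have "length zs \<ge> 2" using neq by (cases zs rule: remdups_adj.cases) (auto simp: is_path_iff)
      moreover have "T (last zs) x" using zs T assms(1) by (simp add: graph_def)
      ultimately have "is_cycle V T (x # zs)"
        using zs T x by (auto simp: is_cycle_def is_path_iff successively_Cons)
      then show False using assms(2) by blast
    qed
    then show ?thesis using Cons.IH px py ends ys by blast
  qed
qed (simp add: is_path_iff)

lemma normal_spanning_tree_ancestry:
  assumes "graph V E" "normal_spanning_tree V E T r"
  shows "\<exists>A. normal_ancestry V E r A"
proof -
  have r: "r \<in> V" and T: "graph V T" "\<And>x y. T x y \<Longrightarrow> E x y" "connected_graph V T"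
    "\<nexists>xs. is_cycle V T xs"
    and le: "\<And>x y. E x y \<Longrightarrow> tree_le V T r x y \<or> tree_le V T r y x"
    using assms(2) by (auto simp: normal_spanning_tree_def spanning_tree_def is_tree_def)
  have "\<forall>v\<in>V. \<exists>xs. is_path V T xs \<and> hd xs = r \<and> last xs = v"
    using T(3) r by (simp add: connected_graph_def)
  then obtain A where A: "\<And>v. v \<in> V \<Longrightarrow> is_path V T (A v) \<and> hd (A v) = r \<and> last (A v) = v"
    by metis
  have A_unique: "xs = A v" if "is_path V T xs" "hd xs = r" "last xs = v" "v \<in> V" for xs v
    using acyclic_path_unique[OF T(1,4)] A that by metis
  have le_A: "x \<in> set (A y)" if "tree_le V T r x y" for x y
  proof -
    obtain xs where xs: "is_path V T xs" "hd xs = r" "last xs = y" "x \<in> set xs"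
      using \<open>tree_le V T r x y\<close> by (auto simp: tree_le_def)
    then have "y \<in> V" using last_in_set[of xs] by (auto simp: is_path_iff)
    then show ?thesis using A_unique xs by metis
  qed
  have "normal_ancestry V E r A"
  proof
    fix v assume v: "v \<in> V"
    show "is_path V E (A v)" using A[OF v] T(2) by (auto simp: is_path_def)
    fix ys u zs assume eq: "A v = ys @ u # zs"
    then have p: "is_path V T ((ys @ [u]) @ zs)" using A[OF v] by simp
    have "is_path V T (ys @ [u])" using is_path_appendD1[OF p] by simp
    moreover have "hd (ys @ [u]) = r" using A[OF v] eq by (auto simp: hd_append)
    moreover have "u \<in> V" using A[OF v] eq by (auto simp: is_path_iff)
    ultimately show "A u = ys @ [u]" using A_unique by simp
  next
    fix x y assume "E x y"
    then show "x \<in> set (A y) \<or> y \<in> set (A x)" using le le_A by metis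
  qed (use assms(1) r A in auto)
  then show ?thesis by blast
qed

subsection \<open>Growing a normal tree\<close>

text \<open>The initial segment of \<open>Q\<close> up to its last vertex with a neighbour in
  \<open>C\<close>: it keeps all neighbours of \<open>C\<close> on \<open>Q\<close> and ends at the
  highest one.\<close>

definition truncate :: "('a \<Rightarrow> 'a \<Rightarrow> bool) \<Rightarrow> 'a list \<Rightarrow> 'a set \<Rightarrow> 'a list" where
  "truncate E Q C = rev (dropWhile (\<lambda>q. \<not> (\<exists>c\<in>C. E q c)) (rev Q))"

lemma truncate_prefix:
  obtains zs where "truncate E Q C @ zs = Q" "\<And>z c. z \<in> set zs \<Longrightarrow> c \<in> C \<Longrightarrow> \<not> E z c"
proof
  let ?P = "\<lambda>q. \<not> (\<exists>c\<in>C. E q c)"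
  have "truncate E Q C @ rev (takeWhile ?P (rev Q)) = rev (rev Q)"
    unfolding truncate_def rev_append[symmetric] takeWhile_dropWhile_id ..
  then show "truncate E Q C @ rev (takeWhile ?P (rev Q)) = Q" by simp
  show "\<not> E z c" if "z \<in> set (rev (takeWhile ?P (rev Q)))" "c \<in> C" for z c
    using that by (auto dest: set_takeWhileD)
qed

lemma truncate_contains:
  assumes "q \<in> set Q" "c \<in> C" "E q c"
  shows "q \<in> set (truncate E Q C)"
proof -
  obtain zs where zs: "truncate E Q C @ zs = Q" "\<And>z c. z \<in> set zs \<Longrightarrow> c \<in> C \<Longrightarrow> \<not> E z c"
    using truncate_prefix[of E Q C] by blast
  have "q \<in> set (truncate E Q C @ zs)" using assms(1) unfolding zs(1) .
  moreover have "q \<notin> set zs" using zs(2) assms(2,3) by blast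
  ultimately show ?thesis by simp
qed

lemma set_truncate: "set (truncate E Q C) \<subseteq> set Q"
  unfolding truncate_def by (auto dest: set_dropWhileD)

lemma last_truncate:
  assumes "truncate E Q C \<noteq> []"
  shows "\<exists>c\<in>C. E (last (truncate E Q C)) c"
  using assms hd_dropWhile[of "\<lambda>q. \<not> (\<exists>c\<in>C. E q c)" "rev Q"]
  unfolding truncate_def last_rev by simp

locale covered_graph =
  fixes V :: "'a set" and E :: "'a \<Rightarrow> 'a \<Rightarrow> bool" and U :: "nat \<Rightarrow> 'a set"
  assumes graph: "graph V E" and connected: "connected_graph V E" and cover: "V = (\<Union>k. U k)"
begin

lemma sym: "symp E"
  using graph by (rule graph_symp)

lemma edge_sym: "E x y \<Longrightarrow> E y x"
  using sym by (rule sympD)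

text \<open>Every target is scheduled infinitely often: either some \<open>U k\<close>, or the neighbourhood
  of the \<open>i\<close>-th vertex of the current root path \<open>X\<close>.\<close>

definition target :: "'a list \<Rightarrow> nat \<Rightarrow> 'a set" where
  "target X n = (case sum_decode (fst (prod_decode n)) of
     Inl k \<Rightarrow> U k | Inr i \<Rightarrow> {y. i < length X \<and> E (X ! i) y})"

definition extends :: "'a list \<Rightarrow> 'a set \<Rightarrow> nat \<Rightarrow> 'a list \<Rightarrow> bool" where
  "extends X D n Q \<longleftrightarrow> is_path D E Q \<and> (X \<noteq> [] \<longrightarrow> E (last X) (hd Q)) \<and>
     (D \<inter> target X n \<noteq> {} \<longrightarrow> set Q \<inter> target X n \<noteq> {})"

text \<open>The choice depends only on the state and the round, so all vertices of one component
  receive the same path.\<close>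

definition extension :: "'a list \<Rightarrow> 'a set \<Rightarrow> nat \<Rightarrow> 'a list" where
  "extension X D n = (SOME Q. extends X D n Q)"

text \<open>\<open>D\<close> is a component of what is not yet in the tree, and \<open>X\<close> is the tree path
  from the root to the highest neighbour of \<open>D\<close>.\<close>

definition state :: "'a list \<Rightarrow> 'a set \<Rightarrow> bool" where
  "state X D \<longleftrightarrow> D \<noteq> {} \<and> D \<subseteq> V \<and> conn E D \<and>
     distinct X \<and> set X \<subseteq> V \<and> successively E X \<and> set X \<inter> D = {} \<and>
     (\<forall>x\<in>D. \<forall>y. E x y \<longrightarrow> y \<in> D \<union> set X) \<and> (X \<noteq> [] \<longrightarrow> (\<exists>y\<in>D. E (last X) y))"

lemma ex_extension:
  assumes "state X D"
  shows "extends X D n (extension X D n)"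
proof -
  obtain y where y: "y \<in> D" "X \<noteq> [] \<Longrightarrow> E (last X) y"
    using assms unfolding state_def by (cases "X = []") auto
  obtain a where a: "a \<in> D" "D \<inter> target X n \<noteq> {} \<Longrightarrow> a \<in> target X n"
    using y by (cases "D \<inter> target X n = {}") auto
  have "linked E D y a" using assms y a by (simp add: state_def conn_def)
  then obtain Q where Q: "is_path D E Q" "hd Q = y" "last Q = a" using linked_ex_path by metis
  then have "a \<in> set Q" by (auto simp: is_path_iff)
  then have "extends X D n Q" using Q y a by (auto simp: extends_def)
  then show ?thesis unfolding extension_def by (rule someI)
qed

text \<open>The neighbours of the smaller component \<open>C\<close> lie on \<open>X\<close> or
  \<open>Q\<close>, and truncation loses none of those on \<open>Q\<close>. Hence they stay on a
  single path that ends at the highest of them.\<close>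

lemma state_step:
  assumes "state X D" "extends X D n Q" "v \<in> D - set Q"
  defines "C \<equiv> component E (D - set Q) v"
  shows "state (X @ truncate E Q C) C" "truncate E Q C \<noteq> []"
proof -
  let ?P = "truncate E Q C"
  have D: "D \<subseteq> V" "conn E D" and X: "distinct X" "set X \<subseteq> V" "successively E X" "set X \<inter> D = {}"
    and N: "\<And>x y. x \<in> D \<Longrightarrow> E x y \<Longrightarrow> y \<in> D \<union> set X"
    using assms(1) by (auto simp: state_def)
  have Q: "is_path D E Q" "X \<noteq> [] \<Longrightarrow> E (last X) (hd Q)"
    using assms(2) by (auto simp: extends_def)
  have Q_D: "Q \<noteq> []" "set Q \<subseteq> D" "distinct Q" "successively E Q" using Q(1) by (auto simp: is_path_iff)
  have v: "v \<in> C" unfolding C_def using assms(3) component_self by metis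
  have C: "C \<subseteq> D - set Q" unfolding C_def by (rule component_subset)
  have N_C: "y \<in> C \<or> y \<in> set X \<or> y \<in> set ?P" if "x \<in> C" "E x y" for x y
  proof -
    have "y \<in> D \<union> set X" using N[of x y] that C by blast
    moreover have "y \<in> C" if "y \<in> D - set Q"
      using component_edge[of x E "D - set Q" v y] \<open>x \<in> C\<close> \<open>E x y\<close> that unfolding C_def by blast
    moreover have "y \<in> set ?P" if "y \<in> set Q"
      using that \<open>x \<in> C\<close> edge_sym[OF \<open>E x y\<close>] by (rule truncate_contains)
    ultimately show ?thesis by blast
  qed
  \<comment> \<open>Since \<open>D\<close> is connected and contains \<open>Q\<close> besides
    \<open>C\<close>, some edge leaves \<open>C\<close> inside \<open>D\<close>; it can only end on
    the truncated path.\<close>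
  obtain a b where ab: "a \<in> D \<inter> C" "b \<in> D - C" "E a b"
    using conn_boundary_edge[OF D(2), of v C "hd Q"] v C Q_D hd_in_set[OF Q_D(1)] assms(3) by blast
  then have "b \<in> set ?P" using N_C[of a b] X(4) by blast
  then show ne: "?P \<noteq> []" by auto
  obtain zs where zs: "?P @ zs = Q" using truncate_prefix[of E Q C] by blast
  have "distinct (?P @ zs)" "successively E (?P @ zs)" "hd (?P @ zs) = hd Q"
    unfolding zs using Q_D by simp_all
  then have P: "distinct ?P" "successively E ?P" "hd ?P = hd Q" "set ?P \<subseteq> set Q"
    using ne set_truncate by (simp_all add: successively_append_iff)
  show "state (X @ ?P) C"
    unfolding state_def
  proof (intro conjI)
    show "C \<noteq> {}" using v by blast
    show "C \<subseteq> V" using C D by blast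
    show "conn E C" unfolding C_def by (rule conn_component[OF sym])
    show "distinct (X @ ?P)" using X P Q_D by auto
    show "set (X @ ?P) \<subseteq> V" using X P Q_D D by auto
    show "successively E (X @ ?P)" using X P Q by (auto simp: successively_append_iff)
    show "set (X @ ?P) \<inter> C = {}" using X P C by auto
    show "\<forall>x\<in>C. \<forall>y. E x y \<longrightarrow> y \<in> C \<union> set (X @ ?P)" using N_C by auto
    show "X @ ?P \<noteq> [] \<longrightarrow> (\<exists>y\<in>C. E (last (X @ ?P)) y)" using last_truncate[OF ne] ne by simp
  qed
qed

text \<open>The state of the component containing \<open>v\<close> after \<open>n\<close> rounds; its second part is empty
  once \<open>v\<close> has been added to the tree.\<close>

fun run :: "'a \<Rightarrow> nat \<Rightarrow> 'a list \<times> 'a set" where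
  "run v 0 = ([], V)"
| "run v (Suc n) = (let X = fst (run v n); D = snd (run v n); Q = extension X D n;
     C = component E (D - set Q) v in (X @ truncate E Q C, C))"

definition root_path :: "'a \<Rightarrow> nat \<Rightarrow> 'a list" where "root_path v n = fst (run v n)"

definition rest :: "'a \<Rightarrow> nat \<Rightarrow> 'a set" where "rest v n = snd (run v n)"

definition new_path :: "'a \<Rightarrow> nat \<Rightarrow> 'a list" where "new_path v n = extension (root_path v n) (rest v n) n"

lemma root_path_rest_0: "root_path v 0 = []" "rest v 0 = V"
  by (simp_all add: root_path_def rest_def)

lemma rest_Suc: "rest v (Suc n) = component E (rest v n - set (new_path v n)) v"
  by (simp add: rest_def new_path_def root_path_def Let_def)

lemma root_path_Suc: "root_path v (Suc n) = root_path v n @ truncate E (new_path v n) (rest v (Suc n))"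
  unfolding rest_Suc by (simp add: rest_def new_path_def root_path_def Let_def)

lemma self_rest_Suc: "v \<in> rest v (Suc n) \<longleftrightarrow> v \<in> rest v n \<and> v \<notin> set (new_path v n)"
  unfolding rest_Suc component_self by blast

lemma rest_Suc_subset: "rest v (Suc n) \<subseteq> rest v n - set (new_path v n)"
  unfolding rest_Suc by (rule component_subset)

lemma rest_antimono: "m \<le> n \<Longrightarrow> rest v n \<subseteq> rest v m"
  by (induction rule: dec_induct) (use rest_Suc_subset in blast)+

lemma state_root_path_rest: "v \<in> rest v n \<Longrightarrow> state (root_path v n) (rest v n)"
proof (induction n)
  case 0
  then show ?case using connected_graph_conn[OF connected] graph
    by (auto simp: root_path_rest_0 state_def graph_def)
next
  case (Suc n)
  then have v: "v \<in> rest v n - set (new_path v n)" using self_rest_Suc by blast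
  then have "state (root_path v n) (rest v n)" using Suc.IH by blast
  from state_step(1)[OF this ex_extension[OF this, of n]] v
  show ?case unfolding root_path_Suc unfolding rest_Suc new_path_def by blast
qed

lemma new_path_extends: "v \<in> rest v n \<Longrightarrow> extends (root_path v n) (rest v n) n (new_path v n)"
  unfolding new_path_def using ex_extension state_root_path_rest by blast

lemma new_path_path: "v \<in> rest v n \<Longrightarrow> is_path (rest v n) E (new_path v n)"
  using new_path_extends unfolding extends_def by blast

lemma truncate_new_path_nonempty:
  assumes "v \<in> rest v (Suc n)"
  shows "truncate E (new_path v n) (rest v (Suc n)) \<noteq> []"
proof -
  have v: "v \<in> rest v n - set (new_path v n)" using assms self_rest_Suc by blast
  then show ?thesis
    using state_step(2)[OF state_root_path_rest new_path_extends v] unfolding rest_Suc by blast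
qed

lemma rest_subset: "rest v n \<subseteq> V"
  using rest_antimono[of 0 n v] by (simp add: root_path_rest_0)

text \<open>Vertices in the same component share their whole history. This makes the runs of the
  individual vertices fit together into one tree.\<close>

lemma run_eq: "u \<in> rest v n \<Longrightarrow> run u n = run v n"
proof (induction n)
  case (Suc n)
  then have "run u n = run v n" using rest_Suc_subset by blast
  then have eq: "root_path u n = root_path v n" "rest u n = rest v n" "new_path u n = new_path v n"
    by (simp_all add: root_path_def rest_def new_path_def)
  have "rest u (Suc n) = rest v (Suc n)"
    using component_eq[OF sym] Suc.prems unfolding rest_Suc eq by blast
  then show ?case using root_path_Suc[of u n] root_path_Suc[of v n] eq
    by (metis rest_def root_path_def prod.collapse)
qed simp

lemma rest_eq: "u \<in> rest v n \<Longrightarrow> root_path u n = root_path v n \<and> rest u n = rest v n \<and> new_path u n = new_path v n"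
  using run_eq[of u v n] by (simp add: root_path_def rest_def new_path_def)

lemma root_path_mono: "m \<le> n \<Longrightarrow> \<exists>zs. root_path v n = root_path v m @ zs"
  by (induction rule: dec_induct) (auto simp: root_path_Suc)

lemma new_path_subset: "v \<in> rest v n \<Longrightarrow> set (new_path v n) \<subseteq> rest v n"
  using new_path_path by (simp add: is_path_iff)

lemma new_path_nonempty: "v \<in> rest v n \<Longrightarrow> new_path v n \<noteq> []"
  using new_path_path by (simp add: is_path_iff)

lemma last_root_path_Suc:
  assumes "v \<in> rest v (Suc n)"
  shows "last (root_path v (Suc n)) \<in> set (new_path v n)" "root_path v (Suc n) \<noteq> []"
  using truncate_new_path_nonempty[OF assms] set_truncate[of E "new_path v n" "rest v (Suc n)"] last_in_set
  by (auto simp: root_path_Suc)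

section \<open>A vertex that is never reached\<close>

definition block :: "'a \<Rightarrow> nat \<Rightarrow> nat \<Rightarrow> 'a set" where
  "block w m n = (\<Union>k\<in>{m..<n}. set (new_path w k))"

text \<open>Such vertices on the branch of \<open>w\<close> become the branch vertices of the
  subdivided clique.\<close>

definition dominating :: "'a \<Rightarrow> 'a \<Rightarrow> bool" where
  "dominating w y \<longleftrightarrow> (\<forall>n. \<exists>z\<in>rest w n. E y z)"

context
  fixes w assumes alive: "\<And>n. w \<in> rest w n"
begin

lemma new_path_disjoint:
  assumes "i < j"
  shows "set (new_path w i) \<inter> set (new_path w j) = {}"
proof -
  have "set (new_path w j) \<subseteq> rest w (Suc i)"
    using new_path_subset[OF alive, of j] rest_antimono[of "Suc i" j w] assms by auto
  then show ?thesis using rest_Suc_subset[of w i] by blast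
qed

text \<open>Each new path starts next to the last vertex of the root path, which lies on the new
  path of the previous round.\<close>

lemma conn_block: "m < n \<Longrightarrow> conn E (block w m n)"
proof (induction n)
  case (Suc n)
  have new_path: "conn E (set (new_path w n))" using conn_path[OF sym new_path_path[OF alive]] .
  show ?case
  proof (cases "m = n")
    case True
    then show ?thesis using new_path by (simp add: block_def)
  next
    case False
    then obtain n' where n': "n = Suc n'" "m \<le> n'" using Suc.prems by (cases n) auto
    have "E (last (root_path w n)) (hd (new_path w n))"
      using new_path_extends[OF alive, of n] last_root_path_Suc(2)[OF alive, of n'] n' by (simp add: extends_def)
    moreover have "last (root_path w n) \<in> block w m n"
      using last_root_path_Suc(1)[OF alive, of n'] n' by (auto simp: block_def)
    moreover have "hd (new_path w n) \<in> set (new_path w n)" using new_path_nonempty[OF alive] by simp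
    moreover have "conn E (block w m n)" using Suc False by simp
    ultimately have "conn E (block w m n \<union> set (new_path w n))" using conn_Un[OF sym] new_path by blast
    moreover have "block w m (Suc n) = block w m n \<union> set (new_path w n)"
      using Suc.prems by (simp add: block_def atLeastLessThanSuc Un_commute)
    ultimately show ?thesis by simp
  qed
qed simp

text \<open>Round \<open>prod_encode (a, n)\<close> has the target coded by \<open>a\<close> and is
  not earlier than \<open>n\<close>.\<close>

lemma target_hit:
  assumes "\<And>m. n \<le> m \<Longrightarrow> rest w m \<inter> T \<noteq> {}"
    and "\<And>m. n \<le> m \<Longrightarrow> fst (prod_decode m) = a \<Longrightarrow> target (root_path w m) m = T"
  shows "\<exists>m\<ge>n. set (new_path w m) \<inter> T \<noteq> {}"
proof -
  define m where "m = prod_encode (a, n)"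
  have m: "n \<le> m" "fst (prod_decode m) = a" by (simp_all add: m_def le_prod_encode_2)
  then have "set (new_path w m) \<inter> T \<noteq> {}"
    using new_path_extends[OF alive, of m] assms by (simp add: extends_def)
  then show ?thesis using m by blast
qed

lemma cover_hit:
  assumes "w \<in> U k"
  shows "\<exists>m\<ge>n. set (new_path w m) \<inter> U k \<noteq> {}"
proof (rule target_hit[where a = "sum_encode (Inl k)"])
  show "rest w m \<inter> U k \<noteq> {}" for m using alive assms by blast
qed (simp add: target_def)

text \<open>Truncation never removes a dominating vertex, and root paths only grow at the end. So
  \<open>y\<close> keeps a fixed position \<open>i\<close> on the root path, and the target coded by
  \<open>Inr i\<close> is its neighbourhood from round \<open>Suc j\<close> on.\<close>

lemma neighbour_hit:
  assumes "dominating w y" "y \<in> set (new_path w j)"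
  shows "\<exists>m\<ge>n. \<exists>z\<in>set (new_path w m). E y z"
proof -
  have "y \<in> set (root_path w (Suc j))"
    using assms truncate_contains[of y "new_path w j" _ "rest w (Suc j)" E]
    by (auto simp: dominating_def root_path_Suc)
  then obtain i where i: "i < length (root_path w (Suc j))" "root_path w (Suc j) ! i = y"
    by (auto simp: in_set_conv_nth)
  have "\<exists>m\<ge>n + Suc j. set (new_path w m) \<inter> {z. E y z} \<noteq> {}"
  proof (rule target_hit[where a = "sum_encode (Inr i)"])
    show "rest w m \<inter> {z. E y z} \<noteq> {}" for m using assms(1) by (auto simp: dominating_def)
    fix m assume m: "n + Suc j \<le> m" "fst (prod_decode m) = sum_encode (Inr i)"
    obtain zs where "root_path w m = root_path w (Suc j) @ zs" using root_path_mono[of "Suc j" m w] m by auto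
    then have "i < length (root_path w m)" "root_path w m ! i = y" using i by (auto simp: nth_append)
    then show "target (root_path w m) m = {z. E y z}" using m by (simp add: target_def)
  qed
  then obtain m where "m \<ge> n + Suc j" "set (new_path w m) \<inter> {z. E y z} \<noteq> {}" by blast
  then show ?thesis by (intro exI[of _ m]) auto
qed

text \<open>The vertices left over at the end of an infinite branch have infinitely many neighbours on
  it, since each component that is cut down is connected.\<close>

lemma dominating_hit: "\<exists>m\<ge>n. \<exists>y\<in>set (new_path w m). dominating w y"
proof -
  \<comment> \<open>\<open>W\<close> is what survives every round along the branch; \<open>C\<close>
    is the component of \<open>w\<close> in it.\<close>
  define W where "W = (\<Inter>n. rest w n)"
  define C where "C = component E W w"
  have C_W: "C \<subseteq> W" unfolding C_def by (rule component_subset)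
  have "w \<in> C" using alive by (simp add: C_def component_self W_def)
  moreover have "hd (new_path w n) \<in> rest w n" "hd (new_path w n) \<notin> rest w (Suc n)"
    using new_path_subset[OF alive, of n] rest_Suc_subset[of w n] hd_in_set[OF new_path_nonempty[OF alive]] by blast+
  moreover have "conn E (rest w n)" using state_root_path_rest[OF alive] by (simp add: state_def)
  \<comment> \<open>The connected set \<open>rest w n\<close> also contains a vertex outside
    \<open>C\<close>, so an edge leaves \<open>C\<close>. Its end \<open>b\<close> is not in
    \<open>W\<close>, since otherwise it would belong to \<open>C\<close>.\<close>
  ultimately obtain a b where ab: "a \<in> C" "b \<in> rest w n" "b \<notin> C" "E a b"
    using conn_boundary_edge[of E "rest w n" w C "hd (new_path w n)"] alive[of n] C_W unfolding W_def by blast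
  have a: "a \<in> rest w j" for j using ab(1) C_W by (auto simp: W_def)
  have "b \<notin> W" using component_edge[of a E W w b] ab unfolding C_def by blast
  then obtain j where "b \<notin> rest w j" by (auto simp: W_def)
  \<comment> \<open>The stage at which \<open>b\<close> disappears. Its neighbour \<open>a\<close>
    survives, so \<open>b\<close> cannot fall into another component and must lie on the new
    path.\<close>
  define m where "m = (LEAST j. b \<notin> rest w j)"
  have m: "b \<notin> rest w m" unfolding m_def by (rule LeastI) fact
  have "n < m" using m ab(2) rest_antimono[of m n w] by (meson linorder_not_le subsetD)
  then obtain m' where m': "m = Suc m'" "n \<le> m'" by (cases m) auto
  have "b \<in> rest w m'" using not_less_Least[of m' "\<lambda>j. b \<notin> rest w j"] m' unfolding m_def by auto
  moreover have "b \<in> rest w (Suc m')" if "b \<in> rest w m' - set (new_path w m')"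
    using component_edge[of a E "rest w m' - set (new_path w m')" w b] a[of "Suc m'"] ab(4) that
    unfolding rest_Suc by blast
  ultimately have "b \<in> set (new_path w m')" using m m' by blast
  moreover have "dominating w b" using a edge_sym[OF ab(4)] by (auto simp: dominating_def)
  ultimately show ?thesis using m' by blast
qed

text \<open>Earlier rounds contain only finitely many dominating vertices. Each gets a neighbour in
  some later round, so a bound beyond all these rounds serves.\<close>

lemma next_block:
  assumes "w \<in> U k"
  shows "\<exists>n>m. (\<exists>y\<in>block w m n. dominating w y) \<and> block w m n \<inter> U k \<noteq> {} \<and>
    (\<forall>y\<in>block w 0 m. dominating w y \<longrightarrow> (\<exists>z\<in>block w m n. E y z))"
proof -
  obtain m1 where m1: "m1 \<ge> m" "\<exists>y\<in>set (new_path w m1). dominating w y" using dominating_hit by blast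
  obtain m2 where m2: "m2 \<ge> m" "set (new_path w m2) \<inter> U k \<noteq> {}" using cover_hit[OF assms] by blast
  define Y where "Y = {y \<in> block w 0 m. dominating w y}"
  have "\<forall>y\<in>Y. \<exists>j\<ge>m. \<exists>z\<in>set (new_path w j). E y z"
    using neighbour_hit by (auto simp: Y_def block_def)
  then obtain g where g: "\<And>y. y \<in> Y \<Longrightarrow> g y \<ge> m \<and> (\<exists>z\<in>set (new_path w (g y)). E y z)" by metis
  have "finite Y" unfolding Y_def block_def by auto
  then have "finite (insert m1 (insert m2 (g ` Y)))" by simp
  then have "\<exists>n. \<forall>x\<in>insert m1 (insert m2 (g ` Y)). x < n"
    by (rule finite_nat_set_iff_bounded[THEN iffD1])
  then obtain n where n: "m1 < n" "m2 < n" "\<And>y. y \<in> Y \<Longrightarrow> g y < n" by blast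
  have new_path_block: "set (new_path w j) \<subseteq> block w m n" if "m \<le> j" "j < n" for j
    using that by (auto simp: block_def)
  have "\<exists>z\<in>block w m n. E y z" if "y \<in> block w 0 m" "dominating w y" for y
  proof -
    have y: "y \<in> Y" using that by (simp add: Y_def)
    then show ?thesis using g[OF y] n(3)[OF y] new_path_block[of "g y"] by blast
  qed
  moreover have "m < n" using m1 n by simp
  moreover have "\<exists>y\<in>block w m n. dominating w y" using m1 n new_path_block[of m1] by blast
  moreover have "block w m n \<inter> U k \<noteq> {}" using m2 n new_path_block[of m2] by blast
  ultimately show ?thesis by blast
qed

text \<open>Iterating \<open>next_block\<close> from round 0 cuts the branch into disjoint connected
  pieces, to which \<open>pieces_not_dispersed\<close> applies with one dominating vertex per
  piece.\<close>

lemma alive_not_dispersed: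
  assumes "w \<in> U k"
  shows "\<not> TK_dispersed V E (U k)"
proof -
  obtain nx where nx: "\<And>m. m < nx m" "\<And>m. \<exists>y\<in>block w m (nx m). dominating w y"
    "\<And>m. block w m (nx m) \<inter> U k \<noteq> {}"
    "\<And>m y. y \<in> block w 0 m \<Longrightarrow> dominating w y \<Longrightarrow> \<exists>z\<in>block w m (nx m). E y z"
    using next_block[OF assms] by metis
  define c where "c l = (nx ^^ l) 0" for l
  define S where "S l = block w (c l) (c (Suc l))" for l
  have c_Suc: "c (Suc l) = nx (c l)" for l by (simp add: c_def)
  have c_mono: "c i \<le> c j" if "i \<le> j" for i j
    using that by (rule lift_Suc_mono_le[of c, rotated]) (use nx(1) c_Suc in \<open>simp add: less_imp_le\<close>)
  have "\<exists>v. \<forall>l. v l \<in> S l \<and> dominating w (v l)"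
    using nx(2) unfolding S_def c_Suc by (intro choice) blast
  then obtain v where v: "\<And>l. v l \<in> S l" "\<And>l. dominating w (v l)" by blast
  show ?thesis
  proof (rule pieces_not_dispersed[where S = S and v = v])
    show "symp E" by (rule sym)
    show "S l \<subseteq> V" for l
      using new_path_subset[OF alive] rest_subset unfolding S_def block_def by blast
    show "conn E (S l)" for l unfolding S_def c_Suc by (rule conn_block) (rule nx(1))
    have "S i \<inter> S j = {}" if "i < j" for i j
    proof -
      have le: "c (Suc i) \<le> c j" using that by (intro c_mono) simp
      have "set (new_path w p) \<inter> set (new_path w q) = {}" if "p < c (Suc i)" "c j \<le> q" for p q
        using new_path_disjoint[of p q] le that by simp
      then show ?thesis unfolding S_def block_def by fastforce
    qed
    then show "S i \<inter> S j = {}" if "i \<noteq> j" for i j using that by (metis Int_commute linorder_neqE_nat)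
    show "v l \<in> S l" for l by (rule v(1))
    show "\<exists>z\<in>S l. E (v i) z" if "i < l" for i l
    proof -
      have "c (Suc i) \<le> c l" using that by (intro c_mono) simp
      then have "S i \<subseteq> block w 0 (c l)" unfolding S_def block_def by (intro UN_mono) auto
      then show ?thesis using nx(4)[of "v i" "c l"] v unfolding S_def c_Suc by blast
    qed
    show "S l \<inter> U k \<noteq> {}" for l unfolding S_def c_Suc by (rule nx(3))
  qed
qed

end

section \<open>Ancestor lists of the grown tree\<close>

text \<open>The round whose new path takes up \<open>v\<close>: a vertex placed in round
  \<open>n\<close> is missing from stage \<open>Suc n\<close> on.\<close>

definition level :: "'a \<Rightarrow> nat" where
  "level v = (LEAST n. v \<notin> rest v (Suc n))"

definition anc :: "'a \<Rightarrow> 'a list" where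
  "anc v = root_path v (level v) @ takeWhile (\<lambda>x. x \<noteq> v) (new_path v (level v)) @ [v]"

lemma level_eq:
  assumes "v \<in> rest v n" "v \<in> set (new_path v n)"
  shows "level v = n"
  unfolding level_def
proof (rule Least_equality)
  show "v \<notin> rest v (Suc n)" using assms self_rest_Suc by blast
  fix m assume "v \<notin> rest v (Suc m)"
  then show "n \<le> m" using assms(1) rest_antimono[of "Suc m" n v] by (meson not_less_eq_eq subsetD)
qed

lemma anc_new_path:
  assumes "v \<in> rest v n" "new_path v n = ys @ u # zs"
  shows "anc u = root_path v n @ ys @ [u]" "level u = n"
proof -
  have "u \<in> rest v n" using new_path_subset[OF assms(1)] assms(2) by auto
  then have eq: "root_path u n = root_path v n" "rest u n = rest v n" "new_path u n = new_path v n" using rest_eq by blast+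
  show "level u = n" using \<open>u \<in> rest v n\<close> eq assms(2) by (intro level_eq) auto
  moreover have "u \<notin> set ys" using new_path_path[OF assms(1)] assms(2) by (auto simp: is_path_iff)
  ultimately show "anc u = root_path v n @ ys @ [u]"
    by (auto simp: anc_def eq assms(2) takeWhile_append)
qed

text \<open>A root path is made of prefixes of earlier new paths, so the list of each entry is
  exactly the part of the root path up to it.\<close>

lemma anc_root_path: "v \<in> rest v n \<Longrightarrow> root_path v n = ys @ u # zs \<Longrightarrow> anc u = ys @ [u]"
proof (induction n arbitrary: zs)
  case 0
  then show ?case by (simp add: root_path_rest_0)
next
  case (Suc n)
  let ?P = "truncate E (new_path v n) (rest v (Suc n))"
  have v: "v \<in> rest v n" using Suc.prems self_rest_Suc by blast
  obtain zs' where zs': "?P @ zs' = new_path v n" using truncate_prefix[of E "new_path v n"] by blast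
  have in_P: "anc u = root_path v n @ us @ [u]" if "?P = us @ u # zs" for us
    using anc_new_path(1)[OF v, of us u "zs @ zs'"] zs' that by simp
  have "root_path v n @ ?P = ys @ u # zs" using Suc.prems by (simp add: root_path_Suc)
  then consider us where "root_path v n = ys @ us" "us @ ?P = u # zs" | us where "root_path v n @ us = ys" "?P = us @ u # zs"
    unfolding append_eq_append_conv2 by blast
  then show ?case
  proof cases
    case 1
    then show ?thesis using Suc.IH[OF v] in_P[of "[]"] by (cases us) auto
  next
    case 2
    then show ?thesis using in_P[of us] by auto
  qed
qed

lemma hd_root_path:
  assumes "v \<in> rest v (Suc n)"
  shows "hd (root_path v (Suc n)) = hd (new_path v 0)"
proof -
  have v: "v \<in> rest v (Suc 0)" using rest_antimono[of "Suc 0" "Suc n" v] assms by auto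
  obtain zs where "truncate E (new_path v 0) (rest v (Suc 0)) @ zs = new_path v 0"
    using truncate_prefix[of E "new_path v 0"] by blast
  then have "hd (truncate E (new_path v 0) (rest v (Suc 0))) = hd (new_path v 0)"
    using truncate_new_path_nonempty[OF v] by (metis hd_append2)
  then have "hd (root_path v (Suc 0)) = hd (new_path v 0)" by (simp add: root_path_Suc root_path_rest_0)
  moreover obtain zs' where "root_path v (Suc n) = root_path v (Suc 0) @ zs'" using root_path_mono[of "Suc 0" "Suc n" v] by auto
  ultimately show ?thesis using last_root_path_Suc(2)[OF v] by simp
qed

text \<open>Two adjacent vertices are not split into different components while both are
  unplaced.\<close>

lemma adjacent_same_rest: "E x y \<Longrightarrow> x \<in> rest x n \<Longrightarrow> y \<in> rest y n \<Longrightarrow> y \<in> rest x n"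
proof (induction n)
  case 0
  then show ?case by (simp add: root_path_rest_0)
next
  case (Suc n)
  then have y: "y \<in> rest x n" using self_rest_Suc by blast
  then have "y \<in> rest x n - set (new_path x n)" using Suc.prems(3) self_rest_Suc[of y n] rest_eq[OF y] by simp
  then show ?case
    using component_edge[of x E "rest x n - set (new_path x n)" x y] Suc.prems(1,2) unfolding rest_Suc by blast
qed

lemma anc_normal_ancestry:
  assumes disp: "\<And>k. TK_dispersed V E (U k)" and v0: "v0 \<in> V"
  shows "normal_ancestry V E (hd (new_path v0 0)) anc"
proof -
  \<comment> \<open>Here dispersedness enters: a vertex surviving all rounds would contradict
    \<open>alive_not_dispersed\<close>.\<close>
  have caught: "v \<in> rest v (level v) \<and> v \<in> set (new_path v (level v))" if v: "v \<in> V" for v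
  proof -
    obtain k where "v \<in> U k" using cover v by blast
    then obtain n where n: "v \<notin> rest v n" using alive_not_dispersed disp by blast
    define m where "m = (LEAST n. v \<notin> rest v n)"
    have m: "v \<notin> rest v m" unfolding m_def using n by (rule LeastI)
    then obtain m' where m': "m = Suc m'" using v by (cases m) (auto simp: root_path_rest_0)
    then have "v \<in> rest v m'" using not_less_Least[of m' "\<lambda>n. v \<notin> rest v n"] unfolding m_def by auto
    moreover have "v \<in> set (new_path v m')" using m m' calculation self_rest_Suc by blast
    ultimately show ?thesis using level_eq by metis
  qed
  have split: "\<exists>ys zs. new_path v (level v) = ys @ v # zs \<and> anc v = root_path v (level v) @ ys @ [v]"
    if "v \<in> V" for v
    using split_list[of v "new_path v (level v)"] caught[OF that] anc_new_path(1) by metis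
  \<comment> \<open>If both are placed in the same round, they lie on the same new path. Otherwise
    \<open>y\<close> is still unplaced after the round of \<open>x\<close>, so truncation keeps its
    neighbour \<open>x\<close> on the root path of \<open>y\<close>.\<close>
  have ancestor: "x \<in> set (anc y) \<or> y \<in> set (anc x)" if "E x y" "level x \<le> level y" for x y
  proof -
    have V: "x \<in> V" "y \<in> V" using graph \<open>E x y\<close> by (auto simp: graph_def)
    define n where "n = level x"
    have x: "x \<in> rest x n" "x \<in> set (new_path x n)" using caught[OF V(1)] by (simp_all add: n_def)
    have "y \<in> rest y n" using caught[OF V(2)] rest_antimono[of n "level y" y] that(2) by (auto simp: n_def)
    then have "y \<in> rest x n" using adjacent_same_rest that(1) x by blast
    then have new_path: "new_path y n = new_path x n" and root_path: "root_path y n = root_path x n" using rest_eq by blast+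
    show ?thesis
    proof (cases "level y = n")
      case True
      obtain ys zs where xs: "new_path x n = ys @ x # zs" "anc x = root_path x n @ ys @ [x]"
        using split[OF V(1)] by (auto simp: n_def)
      obtain ys' zs' where ys: "new_path x n = ys' @ y # zs'" "anc y = root_path x n @ ys' @ [y]"
        using split[OF V(2)] True new_path root_path by auto
      have "x = y \<or> x \<in> set ys' \<or> y \<in> set ys"
        using xs(1) ys(1) by (auto simp: append_eq_append_conv2 append_eq_Cons_conv Cons_eq_append_conv)
      then show ?thesis using xs(2) ys(2) by auto
    next
      case False
      then have le: "Suc n \<le> level y" using that(2) by (simp add: n_def)
      then have "y \<in> rest y (Suc n)" using caught[OF V(2)] rest_antimono[OF le] by blast
      then have "x \<in> set (truncate E (new_path y n) (rest y (Suc n)))"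
        using truncate_contains[of x "new_path y n" y "rest y (Suc n)" E] new_path x that(1) by simp
      then have "x \<in> set (root_path y (Suc n))" by (simp add: root_path_Suc)
      then have "x \<in> set (root_path y (level y))" using root_path_mono[OF le, of y] by auto
      then show ?thesis by (simp add: anc_def)
    qed
  qed
  show ?thesis
  proof
    show "graph V E" by (rule graph)
    have "v0 \<in> rest v0 0" using v0 by (simp add: root_path_rest_0)
    from hd_in_set[OF new_path_nonempty[OF this]] new_path_subset[OF this]
    show "hd (new_path v0 0) \<in> V" by (auto simp: root_path_rest_0)
    fix v assume v: "v \<in> V"
    define n where "n = level v"
    have rest: "v \<in> rest v n" using caught[OF v] by (simp add: n_def)
    obtain ys zs where split: "new_path v n = ys @ v # zs" "anc v = root_path v n @ ys @ [v]"
      using split[OF v] by (auto simp: n_def)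
    have st: "state (root_path v n) (rest v n)" using state_root_path_rest[OF rest] .
    have new_path: "extends (root_path v n) (rest v n) n (new_path v n)" using new_path_extends[OF rest] .
    have path: "is_path (rest v n) E ((ys @ [v]) @ zs)" using new_path split by (simp add: extends_def)
    have path': "is_path (rest v n) E (ys @ [v])" using is_path_appendD1[OF path] by simp
    have hd: "hd (ys @ [v]) = hd (new_path v n)" using split(1) by (cases ys) auto
    show "last (anc v) = v" using split by simp
    show "is_path V E (anc v)"
      using st new_path path' hd unfolding split(2) state_def extends_def
      by (auto simp: is_path_iff successively_append_iff)
    \<comment> \<open>The first path is \<open>extension [] V 0\<close> for every vertex, so all
      lists begin at the same root.\<close>
    show "hd (anc v) = hd (new_path v0 0)"
    proof (cases n)
      case 0
      then show ?thesis using hd split(2) by (simp add: new_path_def root_path_rest_0)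
    next
      case (Suc n')
      then have "hd (root_path v n) = hd (new_path v 0)" "root_path v n \<noteq> []" using rest hd_root_path last_root_path_Suc(2) by blast+
      then show ?thesis using split(2) by (simp add: new_path_def root_path_rest_0)
    qed
    fix ys' u zs' assume eq: "anc v = ys' @ u # zs'"
    \<comment> \<open>\<open>u\<close> lies on the old root path or on the new path;
      \<open>us = []\<close> in the first case means that \<open>u\<close> is the first vertex of
      the new path.\<close>
    then consider us where "root_path v n = ys' @ us" "us @ ys @ [v] = u # zs'"
      | us where "root_path v n @ us = ys'" "ys @ [v] = us @ u # zs'"
      unfolding split(2) append_eq_append_conv2 by blast
    then show "anc u = ys' @ [u]"
    proof cases
      case 1
      show ?thesis
      proof (cases us)
        case Nil
        then have "new_path v n = [] @ u # (zs' @ zs)" using 1 split(1) by (metis append.assoc append_Cons append_Nil)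
        then show ?thesis using anc_new_path(1)[OF rest] 1 Nil by fastforce
      next
        case (Cons a us')
        then show ?thesis using anc_root_path[OF rest] 1 by auto
      qed
    next
      case 2
      then have "new_path v n = us @ u # (zs' @ zs)" using split(1) by (metis append.assoc append_Cons append_Nil)
      then show ?thesis using anc_new_path(1)[OF rest] 2 by fastforce
    qed
  next
    fix x y assume "E x y"
    then show "x \<in> set (anc y) \<or> y \<in> set (anc x)"
      using ancestor[of x y] ancestor[of y x] edge_sym by (meson linear)
  qed
qed

end

theorem theorem3:
  fixes V :: "'a set" and E :: "'a \<Rightarrow> 'a \<Rightarrow> bool"
  assumes "graph V E" and "connected_graph V E"
  shows "(\<exists>T r. normal_spanning_tree V E T r) \<longleftrightarrow>
         (\<exists>Vn :: nat \<Rightarrow> 'a set. (\<forall>n. Vn n \<subseteq> V \<and> TK_dispersed V E (Vn n)) \<and> V = (\<Union>n. Vn n))"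
proof
  assume "\<exists>T r. normal_spanning_tree V E T r"
  then obtain r A where "normal_ancestry V E r A"
    using normal_spanning_tree_ancestry[OF assms(1)] by blast
  then interpret normal_ancestry V E r A .
  have "\<exists>n. length (A v) = Suc n" if "v \<in> V" for v
    using A_nonempty[OF that] by (cases "A v") auto
  \<comment> \<open>Ancestor lists are nonempty, so level \<open>n\<close> consists of the vertices
    with lists of length \<open>Suc n\<close>.\<close>
  then have "V = (\<Union>n. {v \<in> V. length (A v) = Suc n})" by blast
  then show "\<exists>Vn :: nat \<Rightarrow> 'a set. (\<forall>n. Vn n \<subseteq> V \<and> TK_dispersed V E (Vn n)) \<and> V = (\<Union>n. Vn n)"
    using level_dispersed by (intro exI[of _ "\<lambda>n. {v \<in> V. length (A v) = Suc n}"]) auto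
next
  assume "\<exists>Vn :: nat \<Rightarrow> 'a set. (\<forall>n. Vn n \<subseteq> V \<and> TK_dispersed V E (Vn n)) \<and> V = (\<Union>n. Vn n)"
  then obtain U :: "nat \<Rightarrow> 'a set" where
    U: "\<forall>n. U n \<subseteq> V \<and> TK_dispersed V E (U n)" "V = (\<Union>n. U n)"
    by (elim exE conjE) (rule that)
  interpret covered_graph V E U by (rule covered_graph.intro[OF assms U(2)])
  obtain v0 where "v0 \<in> V" using assms(2) by (auto simp: connected_graph_def)
  then interpret normal_ancestry V E "hd (new_path v0 0)" anc
    using U(1) by (intro anc_normal_ancestry) simp_all
  show "\<exists>T r. normal_spanning_tree V E T r" using tree_edge_normal by blast
qed

end
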